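(* The formula "there exists a surjection from $\gimel\kappa_+$ onto $2^{\gimel\kappa}$" is realized in $\mathcal N_{\mathcal A}$.
   Context: Realizability algebra $\mathcal A$ (terms $\Lambda$, stacks $\Pi$, instructions $B,C,I,K,W,\mathrm{cc}$, continuations $k_\pi$, execution $\succ$ given by $(\xi)\eta\star\pi\succ\xi\star\eta\cdot\pi$, $I\star\xi\cdot\pi\succ\xi\star\pi$, $K\star\xi\cdot\eta\cdot\pi\succ\xi\star\pi$, $W\star\xi\cdot\eta\cdot\pi\succ\xi\star\eta\cdot\eta\cdot\pi$, $C\star\xi\cdot\eta\cdot\zeta\cdot\pi\succ\xi\star\zeta\cdot\eta\cdot\pi$, $B\star\xi\cdot\eta\cdot\zeta\cdot\pi\succ\xi\star(\eta)\zeta\cdot\pi$, $\mathrm{cc}\star\xi\cdot\pi\succ\xi\star k_\pi\cdot\pi$, $k_\pi\star\xi\cdot\varpi\succ\xi\star\pi$; a set $\perp\!\!\!\perp$ of processes closed under anti-execution; proof-like terms QP), coherent, in a ground model $\mathcal M\models$ ZF+$V=L$. The realizability model $\mathcal N_{\mathcal A}$ has the individuals of $\mathcal M$, with $\|\top\|=\emptyset$, $\|\bot\|=\Pi$, $\|a\not\varepsilon b\|=\{\pi:(a,\pi)\in b\}$, $\|a\subset b\|=\bigcup_c\{\xi\cdot\pi:(c,\pi)\in a,\xi\Vdash c\notin b\}$, $\|a\notin b\|=\bigcup_c\{\xi\cdot\xi'\cdot\pi:(c,\pi)\in b,\xi\Vdash a\subset c,\xi'\Vdash c\subset a\}$, $\|A\to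 B\|=\{\xi\cdot\pi:\xi\Vdash A,\pi\in\|B\|\}$, $\|\forall xA\|=\bigcup_a\|A[a/x]\|$; $\xi\Vdash F$ iff $\xi\star\pi\in\perp\!\!\!\perp$ for every $\pi\in\|F\|$; a formula is realized if some proof-like term realizes it (it is then read as a ZF statement in $\mathcal N_{\mathcal A}$). For $X\in\mathcal M$, $\gimel X=X\times\Pi$. In $\mathcal M$, $\kappa=\mathrm{card}(\Lambda\cup\Pi\cup\mathbb N)$ and $\kappa_+=\mathcal P(\kappa)$. $2^{\gimel\kappa}$ is the power set of $\gimel\kappa$ in $\mathcal N_{\mathcal A}$. *)

theory Defs
  imports Main
begin

section \<open>Models of ZF + V=L\<close>

datatype fm = Mem nat nat | Equal nat nat | Neg fm | Conj fm fm | Forall fm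

text \<open>De Bruijn indices: the bound variable of \<^const>\<open>Forall\<close> is variable 0.\<close>

primrec sat :: "('m \<Rightarrow> 'm \<Rightarrow> bool) \<Rightarrow> (nat \<Rightarrow> 'm) \<Rightarrow> fm \<Rightarrow> bool" where
  "sat E e (Mem i j) = E (e i) (e j)"
| "sat E e (Equal i j) = (e i = e j)"
| "sat E e (Neg p) = (\<not> sat E e p)"
| "sat E e (Conj p q) = (sat E e p \<and> sat E e q)"
| "sat E e (Forall p) = (\<forall>x. sat E (case_nat x e) p)"

context
  fixes E :: "'m \<Rightarrow> 'm \<Rightarrow> bool"  (infix "\<in>\<^sub>M" 50)
begin

text \<open>
  The structure is the type \<open>'m\<close> with the relation \<open>E\<close>; it may be ill-founded.  In everything
  below (the two schemas aside), quantification is over individuals of the structure, or over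
  collections of individuals that are constrained to be sets of the structure, so all notions are
  first-order notions evaluated in it.
\<close>

definition ext :: "'m \<Rightarrow> 'm set" where
  "ext a = {x. x \<in>\<^sub>M a}"

definition is_set :: "'m set \<Rightarrow> bool" where
  "is_set S \<longleftrightarrow> (\<exists>a. ext a = S)"

text \<open>The individual with extension \<open>S\<close>; meaningful only if \<open>is_set S\<close>.\<close>

definition coll :: "'m set \<Rightarrow> 'm" where
  "coll S = (THE a. ext a = S)"

definition is_inductive :: "'m \<Rightarrow> bool" where
  "is_inductive a \<longleftrightarrow> (\<exists>z\<in>ext a. ext z = {}) \<and> (\<forall>x\<in>ext a. \<exists>y\<in>ext a. ext y = insert x (ext x))"

definition ZF :: bool where
  "ZF \<longleftrightarrow>
     (\<forall>a b. ext a = ext b \<longrightarrow> a = b) \<and>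
     (\<forall>a. ext a \<noteq> {} \<longrightarrow> (\<exists>x\<in>ext a. ext x \<inter> ext a = {})) \<and>
     (\<forall>a b. is_set {a, b}) \<and>
     (\<forall>a. is_set (\<Union>x\<in>ext a. ext x)) \<and>
     (\<forall>a. is_set {b. ext b \<subseteq> ext a}) \<and>
     (\<exists>a. is_inductive a) \<and>
     (\<forall>p e a. is_set {x \<in> ext a. sat E (case_nat x e) p}) \<and>
     (\<forall>p e a.
        (\<forall>x\<in>ext a. \<forall>y y'. sat E (case_nat x (case_nat y e)) p \<longrightarrow>
           sat E (case_nat x (case_nat y' e)) p \<longrightarrow> y = y') \<longrightarrow>
        is_set {y. \<exists>x\<in>ext a. sat E (case_nat x (case_nat y e)) p})"

definition opair :: "'m \<Rightarrow> 'm \<Rightarrow> 'm" where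
  "opair a b = coll {coll {a}, coll {a, b}}"

definition cup :: "'m \<Rightarrow> 'm \<Rightarrow> 'm" where
  "cup a b = coll (ext a \<union> ext b)"

definition diff :: "'m \<Rightarrow> 'm \<Rightarrow> 'm" where
  "diff a b = coll (ext a - ext b)"

definition cap :: "'m \<Rightarrow> 'm \<Rightarrow> 'm" where
  "cap a b = coll (ext a \<inter> ext b)"

definition pow :: "'m \<Rightarrow> 'm" where
  "pow a = coll {b. ext b \<subseteq> ext a}"

definition cprod :: "'m \<Rightarrow> 'm \<Rightarrow> 'm" where
  "cprod a b = coll {opair x y | x y. x \<in>\<^sub>M a \<and> y \<in>\<^sub>M b}"

definition succ :: "'m \<Rightarrow> 'm" where
  "succ a = coll (insert a (ext a))"

definition omega :: 'm where
  "omega = coll {n. \<forall>a. is_inductive a \<longrightarrow> n \<in>\<^sub>M a}"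

definition is_fun :: "'m \<Rightarrow> 'm \<Rightarrow> bool" where
  "is_fun f a \<longleftrightarrow>
     (\<forall>p\<in>ext f. \<exists>x y. x \<in>\<^sub>M a \<and> p = opair x y) \<and>
     (\<forall>x\<in>ext a. \<exists>!y. opair x y \<in>\<^sub>M f)"

definition ap :: "'m \<Rightarrow> 'm \<Rightarrow> 'm" where
  "ap f x = (THE y. opair x y \<in>\<^sub>M f)"

definition is_map :: "'m \<Rightarrow> 'm \<Rightarrow> 'm \<Rightarrow> bool" where
  "is_map f a b \<longleftrightarrow> is_fun f a \<and> (\<forall>x\<in>ext a. ap f x \<in>\<^sub>M b)"

definition is_bij :: "'m \<Rightarrow> 'm \<Rightarrow> 'm \<Rightarrow> bool" where
  "is_bij f a b \<longleftrightarrow> is_map f a b \<and> (\<forall>y\<in>ext b. \<exists>!x. x \<in>\<^sub>M a \<and> ap f x = y)"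

definition transitive :: "'m \<Rightarrow> bool" where
  "transitive a \<longleftrightarrow> (\<forall>x\<in>ext a. ext x \<subseteq> ext a)"

text \<open>By the axiom of foundation, a transitive set of transitive sets is an ordinal.\<close>

definition ordinal :: "'m \<Rightarrow> bool" where
  "ordinal a \<longleftrightarrow> transitive a \<and> (\<forall>x\<in>ext a. transitive x)"

definition is_card_of :: "'m \<Rightarrow> 'm \<Rightarrow> bool" where
  "is_card_of k a \<longleftrightarrow>
     ordinal k \<and> (\<exists>f. is_bij f a k) \<and> (\<forall>b\<in>ext k. \<not> (\<exists>f. is_bij f a b))"


subsection \<open>The constructible hierarchy\<close>

definition seqs :: "'m \<Rightarrow> 'm \<Rightarrow> 'm" where
  "seqs a n = coll {s. is_map s n a}"

text \<open>
  \<open>(n, R) \<in> d\<close> is meant for the \<open>n\<close>-ary relations \<open>R\<close> on \<open>a\<close> that are first-order definable over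
  \<open>(a, \<in>)\<close>, \<open>n\<close> being a natural number of the model.  In the last clause, \<open>s\<close> is the restriction
  of \<open>t\<close> to \<open>n\<close>: this is existential quantification over the last variable.
\<close>

definition definability_closed :: "'m \<Rightarrow> 'm \<Rightarrow> bool" where
  "definability_closed a d \<longleftrightarrow> (\<forall>n\<in>ext omega.
     (\<forall>i\<in>ext n. \<forall>j\<in>ext n.
        opair n (coll {s \<in> ext (seqs a n). ap s i \<in>\<^sub>M ap s j}) \<in>\<^sub>M d \<and>
        opair n (coll {s \<in> ext (seqs a n). ap s i = ap s j}) \<in>\<^sub>M d) \<and>
     (\<forall>R. opair n R \<in>\<^sub>M d \<longrightarrow> opair n (diff (seqs a n) R) \<in>\<^sub>M d) \<and>
     (\<forall>R S. opair n R \<in>\<^sub>M d \<longrightarrow> opair n S \<in>\<^sub>M d \<longrightarrow> opair n (cap R S) \<in>\<^sub>M d) \<and>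
     (\<forall>R. opair (succ n) R \<in>\<^sub>M d \<longrightarrow>
        opair n (coll {s \<in> ext (seqs a n). \<exists>t\<in>ext R. ext s \<subseteq> ext t}) \<in>\<^sub>M d))"

definition definable_rel :: "'m \<Rightarrow> 'm \<Rightarrow> 'm \<Rightarrow> bool" where
  "definable_rel a n R \<longleftrightarrow> (\<forall>d. definability_closed a d \<longrightarrow> opair n R \<in>\<^sub>M d)"

text \<open>The set of subsets of \<open>a\<close> definable over \<open>(a, \<in>)\<close> with parameters \<open>s\<close> from \<open>a\<close>.\<close>

definition def_pow :: "'m \<Rightarrow> 'm" where
  "def_pow a = coll {x. \<exists>n s R. n \<in>\<^sub>M omega \<and> s \<in>\<^sub>M seqs a n \<and> definable_rel a (succ n) R \<and>
     ext x = {z \<in> ext a. coll (insert (opair n z) (ext s)) \<in>\<^sub>M R}}"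

text \<open>\<open>g\<close> is the function \<open>b \<mapsto> L\<^sub>b\<close> on the ordinals \<open>b \<le> c\<close>; the last clause covers 0 and limits.\<close>

definition L_hierarchy :: "'m \<Rightarrow> 'm \<Rightarrow> bool" where
  "L_hierarchy c g \<longleftrightarrow> ordinal c \<and> is_fun g (succ c) \<and>
     (\<forall>b\<in>ext c. ap g (succ b) = def_pow (ap g b)) \<and>
     (\<forall>b\<in>ext (succ c). (\<nexists>b'. b = succ b') \<longrightarrow> ext (ap g b) = (\<Union>b'\<in>ext b. ext (ap g b')))"

definition V_eq_L :: bool where
  "V_eq_L \<longleftrightarrow> (\<forall>x. \<exists>c g. L_hierarchy c g \<and> x \<in>\<^sub>M ap g c)"

end


section \<open>Realizability algebras in the ground model\<close>

text \<open>
  Univ components are individuals of the ground model.  A process \<open>\<xi> \<star> \<pi>\<close> is the pair \<open>(\<xi>, \<pi>)\<close>;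
  \<open>Pole\<close> is the set of processes usually written as a double perpendicular sign.
\<close>

record 'm ralg =
  Tm :: 'm
  Stk :: 'm
  App :: 'm
  Push :: 'm
  Kont :: 'm
  iB :: 'm
  iC :: 'm
  iI :: 'm
  iK :: 'm
  iW :: 'm
  icc :: 'm
  Pole :: 'm
  QP :: 'm

text \<open>
  Formulas of the language with the predicates \<open>\<epsilon>\<close>-non-membership, extensional non-membership and
  inclusion, with individuals as parameters; \<open>\<forall>x F\<close> is \<open>Univ (\<lambda>x. F)\<close>.
\<close>

datatype 'm form =
    Top
  | Bot
  | NotEps 'm 'm
  | NotIn 'm 'm
  | Sub 'm 'm
  | Imp "'m form" "'m form"  (infixr "\<^bold>\<rightarrow>" 55)
  | Univ "'m \<Rightarrow> 'm form"  (binder "\<^bold>\<forall>" 50)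

context
  fixes E :: "'m \<Rightarrow> 'm \<Rightarrow> bool"  (infix "\<in>\<^sub>M" 50)
    and A :: "'m ralg"
begin

definition app :: "'m \<Rightarrow> 'm \<Rightarrow> 'm" where
  "app x y = ap E (App A) (opair E x y)"

definition push :: "'m \<Rightarrow> 'm \<Rightarrow> 'm" where
  "push x p = ap E (Push A) (opair E x p)"

definition kont :: "'m \<Rightarrow> 'm" where
  "kont p = ap E (Kont A) p"

inductive step :: "'m \<times> 'm \<Rightarrow> 'm \<times> 'm \<Rightarrow> bool" where
  "x \<in>\<^sub>M Tm A \<Longrightarrow> y \<in>\<^sub>M Tm A \<Longrightarrow> p \<in>\<^sub>M Stk A \<Longrightarrow>
     step (app x y, p) (x, push y p)"
| "x \<in>\<^sub>M Tm A \<Longrightarrow> p \<in>\<^sub>M Stk A \<Longrightarrow>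
     step (iI A, push x p) (x, p)"
| "x \<in>\<^sub>M Tm A \<Longrightarrow> y \<in>\<^sub>M Tm A \<Longrightarrow> p \<in>\<^sub>M Stk A \<Longrightarrow>
     step (iK A, push x (push y p)) (x, p)"
| "x \<in>\<^sub>M Tm A \<Longrightarrow> y \<in>\<^sub>M Tm A \<Longrightarrow> p \<in>\<^sub>M Stk A \<Longrightarrow>
     step (iW A, push x (push y p)) (x, push y (push y p))"
| "x \<in>\<^sub>M Tm A \<Longrightarrow> y \<in>\<^sub>M Tm A \<Longrightarrow> z \<in>\<^sub>M Tm A \<Longrightarrow> p \<in>\<^sub>M Stk A \<Longrightarrow>
     step (iC A, push x (push y (push z p))) (x, push z (push y p))"
| "x \<in>\<^sub>M Tm A \<Longrightarrow> y \<in>\<^sub>M Tm A \<Longrightarrow> z \<in>\<^sub>M Tm A \<Longrightarrow> p \<in>\<^sub>M Stk A \<Longrightarrow>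
     step (iB A, push x (push y (push z p))) (x, push (app y z) p)"
| "x \<in>\<^sub>M Tm A \<Longrightarrow> p \<in>\<^sub>M Stk A \<Longrightarrow>
     step (icc A, push x p) (x, push (kont p) p)"
| "x \<in>\<^sub>M Tm A \<Longrightarrow> p \<in>\<^sub>M Stk A \<Longrightarrow> q \<in>\<^sub>M Stk A \<Longrightarrow>
     step (kont p, push x q) (x, p)"

definition exec :: "'m \<times> 'm \<Rightarrow> 'm \<times> 'm \<Rightarrow> bool" where
  "exec = step\<^sup>*\<^sup>*"

definition realizability_algebra :: bool where
  "realizability_algebra \<longleftrightarrow>
     is_map E (App A) (cprod E (Tm A) (Tm A)) (Tm A) \<and>
     is_map E (Push A) (cprod E (Tm A) (Stk A)) (Stk A) \<and>
     is_map E (Kont A) (Stk A) (Tm A) \<and>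
     ext E (QP A) \<subseteq> ext E (Tm A) \<and>
     {iB A, iC A, iI A, iK A, iW A, icc A} \<subseteq> ext E (QP A) \<and>
     (\<forall>x y. x \<in>\<^sub>M QP A \<longrightarrow> y \<in>\<^sub>M QP A \<longrightarrow> app x y \<in>\<^sub>M QP A) \<and>
     ext E (Pole A) \<subseteq> ext E (cprod E (Tm A) (Stk A)) \<and>
     (\<forall>x p x' p'. x \<in>\<^sub>M Tm A \<longrightarrow> p \<in>\<^sub>M Stk A \<longrightarrow> exec (x, p) (x', p') \<longrightarrow>
        opair E x' p' \<in>\<^sub>M Pole A \<longrightarrow> opair E x p \<in>\<^sub>M Pole A)"

definition coherent :: bool where
  "coherent \<longleftrightarrow> (\<forall>x. x \<in>\<^sub>M QP A \<longrightarrow> (\<exists>p. p \<in>\<^sub>M Stk A \<and> \<not> opair E x p \<in>\<^sub>M Pole A))"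


subsection \<open>Falsity values\<close>

definition orth :: "'m set \<Rightarrow> 'm set" where
  "orth U = {x. x \<in>\<^sub>M Tm A \<and> (\<forall>p\<in>U. opair E x p \<in>\<^sub>M Pole A)}"

text \<open>
  The falsity values of \<open>a \<subset> b\<close> and \<open>a \<notin> b\<close> are defined by a simultaneous recursion on sets, which
  has to be carried out inside the (possibly ill-founded) model: \<open>s\<close> and \<open>n\<close> are sets of the model
  that code the two families of falsity values for \<open>a\<close>, \<open>b\<close> in a transitive set \<open>t\<close>.
\<close>

definition section_at :: "'m \<Rightarrow> 'm \<Rightarrow> 'm \<Rightarrow> 'm set" where
  "section_at s a b = {p. p \<in>\<^sub>M Stk A \<and> opair E (opair E a b) p \<in>\<^sub>M s}"

definition attempt :: "'m \<Rightarrow> 'm \<Rightarrow> 'm \<Rightarrow> bool" where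
  "attempt t s n \<longleftrightarrow> transitive E t \<and> (\<forall>a\<in>ext E t. \<forall>b\<in>ext E t.
     section_at s a b =
       (\<Union>c. {push x p | x p. p \<in>\<^sub>M Stk A \<and> opair E c p \<in>\<^sub>M a \<and> x \<in> orth (section_at n c b)}) \<and>
     section_at n a b =
       (\<Union>c. {push x (push x' p) | x x' p. p \<in>\<^sub>M Stk A \<and> opair E c p \<in>\<^sub>M b \<and>
                x \<in> orth (section_at s a c) \<and> x' \<in> orth (section_at s c a)}))"

primrec falsity :: "'m form \<Rightarrow> 'm set" where
  "falsity Top = {}"
| "falsity Bot = ext E (Stk A)"
| "falsity (NotEps a b) = {p. p \<in>\<^sub>M Stk A \<and> opair E a p \<in>\<^sub>M b}"
| "falsity (NotIn a b) =
     {p. \<exists>t s n. attempt t s n \<and> a \<in>\<^sub>M t \<and> b \<in>\<^sub>M t \<and> p \<in> section_at n a b}"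
| "falsity (Sub a b) =
     {p. \<exists>t s n. attempt t s n \<and> a \<in>\<^sub>M t \<and> b \<in>\<^sub>M t \<and> p \<in> section_at s a b}"
| "falsity (F \<^bold>\<rightarrow> G) = {push x p | x p. x \<in> orth (falsity F) \<and> p \<in> falsity G}"
| "falsity (Univ F) = (\<Union>a. falsity (F a))"

definition realizes :: "'m \<Rightarrow> 'm form \<Rightarrow> bool" where
  "realizes x F \<longleftrightarrow> x \<in> orth (falsity F)"

definition realized :: "'m form \<Rightarrow> bool" where
  "realized F \<longleftrightarrow> (\<exists>x. x \<in>\<^sub>M QP A \<and> realizes x F)"

definition gimel :: "'m \<Rightarrow> 'm" where
  "gimel X = cprod E X (Stk A)"

end


section \<open>Set-theoretic notions in the language of the realizability model\<close>

definition Negation :: "'m form \<Rightarrow> 'm form" where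
  "Negation F = (F \<^bold>\<rightarrow> Bot)"

definition And :: "'m form \<Rightarrow> 'm form \<Rightarrow> 'm form"  (infixr "\<^bold>\<and>" 65) where
  "F \<^bold>\<and> G = ((F \<^bold>\<rightarrow> G \<^bold>\<rightarrow> Bot) \<^bold>\<rightarrow> Bot)"

definition Or :: "'m form \<Rightarrow> 'm form \<Rightarrow> 'm form"  (infixr "\<^bold>\<or>" 60) where
  "F \<^bold>\<or> G = (Negation F \<^bold>\<rightarrow> Negation G \<^bold>\<rightarrow> Bot)"

definition Iff :: "'m form \<Rightarrow> 'm form \<Rightarrow> 'm form"  (infix "\<^bold>\<leftrightarrow>" 54) where
  "F \<^bold>\<leftrightarrow> G = ((F \<^bold>\<rightarrow> G) \<^bold>\<and> (G \<^bold>\<rightarrow> F))"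

definition Exist :: "('m \<Rightarrow> 'm form) \<Rightarrow> 'm form"  (binder "\<^bold>\<exists>" 50) where
  "Exist F = Negation (\<^bold>\<forall>x. Negation (F x))"

definition Eps :: "'m \<Rightarrow> 'm \<Rightarrow> 'm form"  (infix "\<^bold>\<in>" 75) where
  "x \<^bold>\<in> a = Negation (NotEps x a)"

definition Eq :: "'m \<Rightarrow> 'm \<Rightarrow> 'm form"  (infix "\<^bold>=" 75) where
  "x \<^bold>= y = (\<^bold>\<forall>z. NotEps y z \<^bold>\<rightarrow> NotEps x z)"

text \<open>
  The \<open>\<epsilon>\<close>-members of \<open>gimel X\<close> are the elements of \<open>X\<close>, told apart by Leibniz equality.  (For the
  extensional membership relation, on the other hand, all ordinals of the ground model and all
  sets of ordinals are equal to the empty set, because an ordered pair is never an ordinal.)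
  The usual definitions of unordered and ordered pairs, functions and power sets are therefore
  taken with \<open>\<epsilon>\<close> and Leibniz equality.  As \<open>\<epsilon>\<close> is not extensional, these notions are predicates:
  a set does not determine, for instance, a unique power set.
\<close>

definition Is_upair :: "'m \<Rightarrow> 'm \<Rightarrow> 'm \<Rightarrow> 'm form" where
  "Is_upair s x y = (\<^bold>\<forall>u. u \<^bold>\<in> s \<^bold>\<leftrightarrow> (u \<^bold>= x \<^bold>\<or> u \<^bold>= y))"

definition Is_opair :: "'m \<Rightarrow> 'm \<Rightarrow> 'm \<Rightarrow> 'm form" where
  "Is_opair q x y = (\<^bold>\<exists>s. \<^bold>\<exists>t. Is_upair q s t \<^bold>\<and> Is_upair s x x \<^bold>\<and> Is_upair t x y)"

definition Subset :: "'m \<Rightarrow> 'm \<Rightarrow> 'm form" where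
  "Subset x a = (\<^bold>\<forall>z. z \<^bold>\<in> x \<^bold>\<rightarrow> z \<^bold>\<in> a)"

definition Is_pow :: "'m \<Rightarrow> 'm \<Rightarrow> 'm form" where
  "Is_pow P a =
     ((\<^bold>\<forall>y. y \<^bold>\<in> P \<^bold>\<rightarrow> Subset y a) \<^bold>\<and>
      (\<^bold>\<forall>x. Subset x a \<^bold>\<rightarrow> (\<^bold>\<exists>y. y \<^bold>\<in> P \<^bold>\<and> (\<^bold>\<forall>z. z \<^bold>\<in> y \<^bold>\<leftrightarrow> z \<^bold>\<in> x))))"

definition Is_map :: "'m \<Rightarrow> 'm \<Rightarrow> 'm \<Rightarrow> 'm form" where
  "Is_map f a b =
     ((\<^bold>\<forall>q. q \<^bold>\<in> f \<^bold>\<rightarrow> (\<^bold>\<exists>x. \<^bold>\<exists>y. x \<^bold>\<in> a \<^bold>\<and> y \<^bold>\<in> b \<^bold>\<and> Is_opair q x y)) \<^bold>\<and>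
      (\<^bold>\<forall>x. x \<^bold>\<in> a \<^bold>\<rightarrow> (\<^bold>\<exists>y. \<^bold>\<exists>q. q \<^bold>\<in> f \<^bold>\<and> Is_opair q x y)) \<^bold>\<and>
      (\<^bold>\<forall>x. \<^bold>\<forall>y. \<^bold>\<forall>y'. \<^bold>\<forall>q. \<^bold>\<forall>q'. q \<^bold>\<in> f \<^bold>\<rightarrow> q' \<^bold>\<in> f \<^bold>\<rightarrow>
         Is_opair q x y \<^bold>\<rightarrow> Is_opair q' x y' \<^bold>\<rightarrow> y \<^bold>= y'))"

definition Is_surj :: "'m \<Rightarrow> 'm \<Rightarrow> 'm \<Rightarrow> 'm form" where
  "Is_surj f a b =
     (Is_map f a b \<^bold>\<and>
      (\<^bold>\<forall>y. y \<^bold>\<in> b \<^bold>\<rightarrow> (\<^bold>\<exists>x. \<^bold>\<exists>q. x \<^bold>\<in> a \<^bold>\<and> q \<^bold>\<in> f \<^bold>\<and> Is_opair q x y)))"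

definition Exists_surj_onto_pow :: "'m \<Rightarrow> 'm \<Rightarrow> 'm form" where
  "Exists_surj_onto_pow a b = (\<^bold>\<exists>P. Is_pow P b \<^bold>\<and> (\<^bold>\<exists>f. Is_surj f a P))"

end

theory Submission
  imports Defs
begin

text \<open>
  In the ground model, \<open>\<kappa>\<close> is an infinite ordinal, so \<open>\<kappa> \<times> \<kappa>\<close> and hence \<open>\<kappa> \<times> \<Pi>\<close> embed into \<open>\<kappa>\<close>;
  pulling back along an embedding gives a surjection \<open>h\<close> from \<open>\<kappa>\<^sub>+\<close> onto \<open>\<P>(\<kappa> \<times> \<Pi>)\<close>.  In the
  realizability model every subset of \<open>gimel \<kappa>\<close> has the same \<open>\<epsilon>\<close>-elements as its trace on \<open>\<kappa> \<times> \<Pi>\<close>,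
  so that \<open>gimel (\<P>(\<kappa> \<times> \<Pi>))\<close> is a power set of \<open>gimel \<kappa>\<close>.  For a suitable choice of individuals
  \<open>(x, y)\<close> that realize the definition of an ordered pair, \<open>gimel {(x, h x) | x \<in> \<kappa>\<^sub>+}\<close> is the surjection.

  Since the model is an arbitrary structure, the embedding of \<open>\<kappa> \<times> \<kappa>\<close> into \<open>\<kappa>\<close>, obtained by
  collapsing Goedel's well-order of pairs, has to be found among the functions definable in it.
\<close>

text \<open>A universal formula asks for one proof-like term for all its instances, so a case split
  on a ground-model fact cannot be used to select a term. What helps are formulas whose falsity
  value is that of \<open>Bot\<close> or \<open>Top\<close> according to a ground-model condition.
  \<open>NotEps z (gimel E A X)\<close> is of this kind, and Leibniz equality can be tested by it;
  therefore the power set and the graph of the surjection are both taken as \<open>gimel\<close> of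
  a ground-model set, and a split becomes passage to a subset of the instances. A pair cannot be
  treated in this way: which component is meant has to be visible to the realizer. The factor \<Pi>
  in \<kappa> \<times> \<Pi> appears because an individual acts, through its \<epsilon>-members, as
  a set of pairs of an element and a stack; \<kappa> bounds the cardinal of \<Pi>, so this factor
  can be absorbed. In the ground model, separation, replacement and induction hold for formulas
  only. Since the theorem on squares of ordinals is proved by induction, not only the functions but
  also the relation "embeds into" must be definable.\<close>

primrec rename :: "(nat \<Rightarrow> nat) \<Rightarrow> fm \<Rightarrow> fm" where
  "rename f (Mem i j) = Mem (f i) (f j)"
| "rename f (Equal i j) = Equal (f i) (f j)"
| "rename f (Neg p) = Neg (rename f p)"
| "rename f (Conj p q) = Conj (rename f p) (rename f q)"
| "rename f (Forall p) = Forall (rename (case_nat 0 (\<lambda>i. Suc (f i))) p)"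

lemma sat_rename: "sat E e (rename f p) = sat E (\<lambda>i. e (f i)) p"
proof (induction p arbitrary: e f)
  case (Forall p)
  have "(\<lambda>i. case_nat x e (case_nat 0 (\<lambda>i. Suc (f i)) i)) = case_nat x (\<lambda>i. e (f i))" for x
    by (auto split: nat.split)
  then show ?case by (simp add: Forall)
qed auto

definition interleave :: "(nat \<Rightarrow> 'm) \<Rightarrow> (nat \<Rightarrow> 'm) \<Rightarrow> nat \<Rightarrow> 'm" where
  "interleave v e i = (if even i then v (i div 2) else e (i div 2))"

lemma interleave_simps [simp]:
  "interleave v e (2 * i) = v i" "interleave v e (Suc (2 * i)) = e i"
  by (auto simp: interleave_def)

locale zf_model =
  fixes E :: "'m \<Rightarrow> 'm \<Rightarrow> bool"  (infix "\<in>\<^sub>M" 50)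
  assumes ZF: "ZF E"
begin

section \<open>Definable predicates and terms\<close>

text \<open>
  A predicate of valuations is definable if it is given by a formula with parameters; the
  variables of the formula are split into the valuation (even indices) and the parameters (odd
  indices).  Free HOL variables count as parameters, so that the introduction rules below
  recognize a definable predicate from the shape of its HOL definition.
\<close>

definition dfbl :: "((nat \<Rightarrow> 'm) \<Rightarrow> bool) \<Rightarrow> bool" where
  "dfbl P \<longleftrightarrow> (\<exists>p e. \<forall>v. sat E (interleave v e) p = P v)"

definition dtm :: "((nat \<Rightarrow> 'm) \<Rightarrow> 'm) \<Rightarrow> bool" where
  "dtm t \<longleftrightarrow> dfbl (\<lambda>v. v 0 = t (\<lambda>i. v (Suc i)))"

named_theorems dfb

lemma dfbl_eq_var: "dfbl (\<lambda>v. v i = v j)"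
  unfolding dfbl_def by (rule exI[of _ "Equal (2*i) (2*j)"]) simp

lemma dfbl_mem_var: "dfbl (\<lambda>v. v i \<in>\<^sub>M v j)"
  unfolding dfbl_def by (rule exI[of _ "Mem (2*i) (2*j)"]) simp

lemma dfbl_not [dfb]: "dfbl P \<Longrightarrow> dfbl (\<lambda>v. \<not> P v)"
  unfolding dfbl_def by (metis sat.simps(3))

text \<open>The two formulas come with different parameter valuations \<open>e\<close> and
  \<open>d\<close>. These are merged by a second interleaving, and the renamings send parameter k of
  the first formula to place 2k and that of the second to place 2k+1 of the merged
  valuation.\<close>

lemma dfbl_conj [dfb]:
  assumes "dfbl P" "dfbl Q"
  shows "dfbl (\<lambda>v. P v \<and> Q v)"
proof -
  obtain p e where p: "\<And>v. sat E (interleave v e) p = P v" using assms by (auto simp: dfbl_def)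
  obtain q d where q: "\<And>v. sat E (interleave v d) q = Q v" using assms by (auto simp: dfbl_def)
  let ?f = "\<lambda>i. if even i then i else Suc (2 * (2 * (i div 2)))"
  let ?g = "\<lambda>i. if even i then i else Suc (2 * (Suc (2 * (i div 2))))"
  have f: "(\<lambda>i. interleave v (interleave e d) (?f i)) = interleave v e" for v
    by (rule ext) (auto simp: interleave_def elim!: oddE)
  have g: "(\<lambda>i. interleave v (interleave e d) (?g i)) = interleave v d" for v
    by (rule ext) (auto simp: interleave_def elim!: oddE)
  have "\<forall>v. sat E (interleave v (interleave e d)) (Conj (rename ?f p) (rename ?g q)) = (P v \<and> Q v)"
    by (simp only: sat.simps sat_rename f g p q) simp
  then show ?thesis unfolding dfbl_def by blast
qed

lemma dfbl_all [dfb]: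
  assumes "dfbl (\<lambda>v. P (v 0) (\<lambda>i. v (Suc i)))"
  shows "dfbl (\<lambda>v. \<forall>x. P x v)"
proof -
  obtain p e where p: "\<And>v. sat E (interleave v e) p = P (v 0) (\<lambda>i. v (Suc i))"
    using assms by (auto simp: dfbl_def)
  \<comment> \<open>Under the quantifier the bound variable is 0 and all other indices are shifted
    by one. Index 2k of \<open>p\<close> with k > 0 denotes \<open>v (k - 1)\<close>, which outside
    has index 2k-2 and so becomes 2k-1; the odd parameter indices just move up by one.\<close>
  let ?f = "\<lambda>i. if i = 0 then 0 else if even i then i - 1 else Suc i"
  have f: "(\<lambda>i. case_nat x (interleave v e) (?f i)) = interleave (case_nat x v) e" for x v
  proof
    fix i show "case_nat x (interleave v e) (?f i) = interleave (case_nat x v) e i"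
    proof (cases "even i")
      case True
      then obtain k where "i = 2 * k" by (auto elim: evenE)
      then show ?thesis by (cases k) (auto simp: interleave_def)
    qed (auto simp: interleave_def elim!: oddE)
  qed
  have "\<forall>v. sat E (interleave v e) (Forall (rename ?f p)) = (\<forall>x. P x v)"
    by (simp only: sat.simps sat_rename f p) simp
  then show ?thesis unfolding dfbl_def by blast
qed

lemma dfbl_reindex:
  assumes "dfbl P"
  shows "dfbl (\<lambda>v. P (\<lambda>i. v (f i)))"
proof -
  obtain p e where p: "\<And>v. sat E (interleave v e) p = P v" using assms by (auto simp: dfbl_def)
  let ?f = "\<lambda>i. if even i then 2 * f (i div 2) else i"
  have f: "(\<lambda>i. interleave v e (?f i)) = interleave (\<lambda>i. v (f i)) e" for v
    by (auto simp: interleave_def)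
  have "\<forall>v. sat E (interleave v e) (rename ?f p) = P (\<lambda>i. v (f i))"
    by (simp only: sat_rename f p) simp
  then show ?thesis unfolding dfbl_def by blast
qed

lemma dfbl_ex [dfb]:
  assumes "dfbl (\<lambda>v. P (v 0) (\<lambda>i. v (Suc i)))"
  shows "dfbl (\<lambda>v. \<exists>x. P x v)"
proof -
  have "dfbl (\<lambda>v. \<not> (\<forall>x. \<not> P x v))" by (intro dfb assms)
  then show ?thesis by simp
qed

lemma dfbl_disj [dfb]:
  assumes "dfbl P" "dfbl Q"
  shows "dfbl (\<lambda>v. P v \<or> Q v)"
proof -
  have "dfbl (\<lambda>v. \<not> (\<not> P v \<and> \<not> Q v))" by (intro dfb assms)
  then show ?thesis by simp
qed

lemma dfbl_imp [dfb]:
  assumes "dfbl P" "dfbl Q"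
  shows "dfbl (\<lambda>v. P v \<longrightarrow> Q v)"
proof -
  have "dfbl (\<lambda>v. \<not> (P v \<and> \<not> Q v))" by (intro dfb assms)
  then show ?thesis by simp
qed

lemma dfbl_iff [dfb]:
  assumes "dfbl P" "dfbl Q"
  shows "dfbl (\<lambda>v. P v \<longleftrightarrow> Q v)"
proof -
  have "dfbl (\<lambda>v. (P v \<longrightarrow> Q v) \<and> (Q v \<longrightarrow> P v))" by (intro dfb assms)
  then show ?thesis by (simp add: iff_conv_conj_imp)
qed

lemma dfbl_const [dfb]: "dfbl (\<lambda>v. b)"
proof -
  have "dfbl (\<lambda>v. (v 0 = v 0) \<longleftrightarrow> (v 0 = v 0))" "dfbl (\<lambda>v. \<not> ((v 0 = v 0) \<longleftrightarrow> (v 0 = v 0)))"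
    by (intro dfb dfbl_eq_var)+
  then show ?thesis by (cases b) auto
qed

lemma dtm_var [dfb]: "dtm (\<lambda>v. v n)"
  unfolding dtm_def by (rule dfbl_eq_var)

lemma dtm_const [dfb]: "dtm (\<lambda>v. c)"
  unfolding dtm_def dfbl_def
  by (rule exI[of _ "Equal 0 (Suc 0)"], rule exI[of _ "\<lambda>_. c"]) (simp add: interleave_def)

lemma dtm_reindex: "dtm t \<Longrightarrow> dtm (\<lambda>v. t (\<lambda>i. v (f i)))"
  unfolding dtm_def using dfbl_reindex[of _ "case_nat 0 (\<lambda>i. Suc (f i))"] by force

lemma dfbl_subst:
  assumes "dfbl (\<lambda>v. P (v 0) (\<lambda>i. v (Suc i)))" "dtm t"
  shows "dfbl (\<lambda>v. P (t v) v)"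
proof -
  have "dfbl (\<lambda>v. \<exists>x. x = t v \<and> P x v)"
    by (intro dfb assms assms(2)[unfolded dtm_def])
  then show ?thesis by simp
qed

lemma dfbl_subst2:
  assumes "dfbl (\<lambda>v. P (v 0) (v 1))" "dtm t" "dtm s"
  shows "dfbl (\<lambda>v. P (t v) (s v))"
proof -
  have 0: "dtm (\<lambda>v. s (\<lambda>i. v (Suc i)))" by (rule dtm_reindex[OF assms(3)])
  have "dfbl (\<lambda>v. P (v 1) (v 0))"
    using dfbl_reindex[OF assms(1), of "\<lambda>i. 1 - i"] by simp
  then have 1: "dfbl (\<lambda>v. P (v (Suc 1)) (v 0))"
    using dfbl_reindex[of "\<lambda>v. P (v 1) (v 0)" "\<lambda>i. 2 * i"] by (simp add: numeral_2_eq_2)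
  have 2: "dfbl (\<lambda>v. P (v 0) (s (\<lambda>i. v (Suc i))))"
  proof (rule dfbl_subst[of "\<lambda>x v. P (v 0) x", OF _ 0])
    show "dfbl (\<lambda>v. P (v (Suc 0)) (v 0))"
      using dfbl_reindex[OF 1, of "\<lambda>i. i - 1"] by simp
  qed
  show ?thesis by (rule dfbl_subst[of "\<lambda>x v. P x (s v)", OF 2 assms(2)])
qed

lemma dfbl_mem [dfb]: "dtm t \<Longrightarrow> dtm s \<Longrightarrow> dfbl (\<lambda>v. t v \<in>\<^sub>M s v)"
  by (rule dfbl_subst2[of "(\<in>\<^sub>M)"]) (rule dfbl_mem_var)

lemma dfbl_eq [dfb]: "dtm t \<Longrightarrow> dtm s \<Longrightarrow> dfbl (\<lambda>v. t v = s v)"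
  by (rule dfbl_subst2[of "(=)"]) (rule dfbl_eq_var)

text \<open>Classes that are not sets are covered too: there \<open>coll\<close> takes the default
  value of the definite description, the fixed individual \<open>THE a. False\<close>, which enters
  the defining formula as a parameter.\<close>

lemma dtm_coll [dfb]:
  assumes "dfbl (\<lambda>v. P (v 0) (\<lambda>i. v (Suc i)))"
  shows "dtm (\<lambda>v. coll E {x. P x v})"
proof -
  have ext_eq: "ext E a = ext E b \<Longrightarrow> a = b" for a b using ZF by (auto simp: ZF_def)
  have coll: "y = coll E S \<longleftrightarrow> (\<forall>x. x \<in>\<^sub>M y \<longleftrightarrow> x \<in> S) \<or> (\<nexists>z. \<forall>x. x \<in>\<^sub>M z \<longleftrightarrow> x \<in> S) \<and> y = (THE a. False)"
    for y S
  proof (cases "\<exists>z. ext E z = S")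
    case True
    then obtain z where z: "ext E z = S" by blast
    then have c: "coll E S = z" unfolding coll_def by (rule the_equality) (use z ext_eq in blast)
    have S: "x \<in> S \<longleftrightarrow> x \<in>\<^sub>M z" for x using z by (auto simp: ext_def)
    have "y = z" if "\<forall>x. x \<in>\<^sub>M y \<longleftrightarrow> x \<in>\<^sub>M z" using that by (intro ext_eq) (simp add: ext_def)
    then show ?thesis unfolding c S by blast
  next
    case False
    then have "(\<lambda>a. ext E a = S) = (\<lambda>a. False)" by auto
    then have "coll E S = (THE a. False)" unfolding coll_def by simp
    with False show ?thesis by (auto simp: ext_def)
  qed
  have *: "dfbl (\<lambda>v. P (v 0) (\<lambda>i. v (Suc (f i))))" for f
    using dfbl_reindex[OF assms, of "case_nat 0 (\<lambda>i. Suc (f i))"] by simp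
  show ?thesis
    unfolding dtm_def coll mem_Collect_eq
    by (intro dfb) (rule * *[of "\<lambda>i. Suc i"])+
qed

lemma dtm_if [dfb]:
  assumes "dfbl P" "dtm t" "dtm s"
  shows "dtm (\<lambda>v. if P v then t v else s v)"
proof -
  have "dfbl (\<lambda>v. (P (\<lambda>i. v (Suc i)) \<longrightarrow> v 0 = t (\<lambda>i. v (Suc i))) \<and>
     (\<not> P (\<lambda>i. v (Suc i)) \<longrightarrow> v 0 = s (\<lambda>i. v (Suc i))))"
    by (intro dfb dfbl_reindex[OF assms(1)] dtm_reindex[OF assms(2)] dtm_reindex[OF assms(3)])
  then show ?thesis unfolding dtm_def by (rule back_subst[of dfbl]) auto
qed

lemma dfbl_separation:
  assumes "dfbl (\<lambda>v. P (v 0))"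
  shows "is_set E {x. x \<in>\<^sub>M a \<and> P x}"
proof -
  obtain p e where p: "\<And>v. sat E (interleave v e) p = P (v 0)" using assms by (auto simp: dfbl_def)
  \<comment> \<open>Only \<open>v 0\<close> matters to \<open>P\<close>, so every valuation variable
    may be sent to variable 0, the element being tested; it pushes the parameters up by one
    place.\<close>
  let ?f = "\<lambda>i. if even i then 0 else Suc (i div 2)"
  have "(\<lambda>i. case_nat x e (?f i)) = interleave (\<lambda>_. x) e" for x by (auto simp: interleave_def)
  then have "sat E (case_nat x e) (rename ?f p) = P x" for x by (simp only: sat_rename p)
  moreover have "is_set E {x \<in> ext E a. sat E (case_nat x e) (rename ?f p)}"
    using ZF unfolding ZF_def by blast
  ultimately show ?thesis by (simp add: ext_def)
qed

lemma dfbl_replacement: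
  assumes "dfbl (\<lambda>v. P (v 0) (v 1))" and "\<And>x y z. x \<in>\<^sub>M a \<Longrightarrow> P x y \<Longrightarrow> P x z \<Longrightarrow> y = z"
  shows "is_set E {y. \<exists>x. x \<in>\<^sub>M a \<and> P x y}"
proof -
  obtain p e where p: "\<And>v. sat E (interleave v e) p = P (v 0) (v 1)"
    using assms by (auto simp: dfbl_def)
  \<comment> \<open>Valuation variable 0 is the argument, all later ones are sent to the value, and
    the parameters move up by two places.\<close>
  let ?f = "\<lambda>i. if even i then min 1 (i div 2) else Suc (Suc (i div 2))"
  have *: "(\<lambda>i. case_nat x (case_nat y e) (?f i)) = interleave (case_nat x (\<lambda>_. y)) e" for x y
  proof
    fix i show "case_nat x (case_nat y e) (?f i) = interleave (case_nat x (\<lambda>_. y)) e i"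
    proof (cases "even i")
      case True
      then obtain k where "i = 2 * k" by (auto elim: evenE)
      then show ?thesis by (cases k) (simp_all add: interleave_def)
    qed (simp add: interleave_def)
  qed
  have s: "sat E (case_nat x (case_nat y e)) (rename ?f p) = P x y" for x y
    by (simp only: sat_rename p *) simp
  have "(\<forall>x\<in>ext E a. \<forall>y y'. sat E (case_nat x (case_nat y e)) (rename ?f p) \<longrightarrow>
           sat E (case_nat x (case_nat y' e)) (rename ?f p) \<longrightarrow> y = y')"
    unfolding s using assms(2) by (simp add: ext_def)
  then have "is_set E {y. \<exists>x\<in>ext E a. sat E (case_nat x (case_nat y e)) (rename ?f p)}"
    using ZF unfolding ZF_def by blast
  then show ?thesis by (simp add: s ext_def)
qed

end

context zf_model
begin

section \<open>Basic set theory in the model\<close>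

lemma mem_ext [simp]: "x \<in> ext E a \<longleftrightarrow> x \<in>\<^sub>M a"
  by (simp add: ext_def)

lemma extensionality: "(\<And>x. x \<in>\<^sub>M a \<longleftrightarrow> x \<in>\<^sub>M b) \<Longrightarrow> a = b"
  using ZF by (simp add: ZF_def ext_def)

lemma eq_iff_members: "a = b \<longleftrightarrow> (\<forall>x. x \<in>\<^sub>M a \<longleftrightarrow> x \<in>\<^sub>M b)"
  using extensionality by blast

lemma mem_coll: "is_set E S \<Longrightarrow> x \<in>\<^sub>M coll E S \<longleftrightarrow> x \<in> S"
proof -
  assume "is_set E S"
  then obtain a where a: "ext E a = S" by (auto simp: is_set_def)
  then have "coll E S = a"
    unfolding coll_def by (rule the_equality) (use a in \<open>auto intro!: extensionality simp: ext_def\<close>)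
  with a show ?thesis by auto
qed

lemma coll_ext [simp]: "coll E {x. x \<in>\<^sub>M a} = a"
  unfolding coll_def by (rule the_equality) (auto intro!: extensionality simp: ext_def)

lemma is_set_subclass:
  assumes "dfbl (\<lambda>v. P (v 0))" "\<And>x. P x \<Longrightarrow> x \<in>\<^sub>M a"
  shows "is_set E {x. P x}"
proof -
  have "{x. P x} = {x. x \<in>\<^sub>M a \<and> P x}" using assms by blast
  then show ?thesis using dfbl_separation[OF assms(1)] by simp
qed

lemma is_set_image:
  assumes "dtm (\<lambda>v. F (v 0))"
  shows "is_set E {y. \<exists>x. x \<in>\<^sub>M a \<and> y = F x}"
proof (rule dfbl_replacement)
  show "dfbl (\<lambda>v. v 1 = F (v 0))"
    using dfbl_reindex[OF assms[unfolded dtm_def], of "\<lambda>i. 1 - i"] by simp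
qed auto

lemma dtm_app:
  assumes "dtm (\<lambda>v. F (v 0))" "dtm t"
  shows "dtm (\<lambda>v. F (t v))"
proof -
  have "dfbl (\<lambda>v. v 0 = F (v 1))" using assms(1) by (simp add: dtm_def)
  then show ?thesis
    unfolding dtm_def by (rule dfbl_subst2) (rule dtm_var dtm_reindex[OF assms(2)])+
qed

lemma dtm_app2:
  assumes "dtm (\<lambda>v. F (v 0) (v 1))" "dtm t" "dtm s"
  shows "dtm (\<lambda>v. F (t v) (s v))"
proof -
  have "dfbl (\<lambda>v. v 0 = F (v 1) (v 2))" using assms(1) by (simp add: dtm_def numeral_2_eq_2)
  then have 1: "dfbl (\<lambda>v. v 2 = F (v 0) (v 1))"
    using dfbl_reindex[of "\<lambda>v. v 0 = F (v 1) (v 2)" "\<lambda>i. if i = 0 then 2 else i - 1"] by simp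
  have 2: "dfbl (\<lambda>v. v (Suc (Suc 0)) = F (v (Suc 0)) (v 0))"
    using dfbl_reindex[OF 1, of "\<lambda>i. if i = 2 then 2 else 1 - i"] by (simp add: numeral_2_eq_2)
  have "dfbl (\<lambda>v. \<exists>x y. x = t (\<lambda>i. v (Suc i)) \<and> y = s (\<lambda>i. v (Suc i)) \<and> v 0 = F x y)"
    by (intro dfbl_ex dfbl_conj 2 dfbl_eq dtm_reindex[OF assms(2)] dtm_reindex[OF assms(3)] dtm_var)
  then show ?thesis unfolding dtm_def by simp
qed

lemma dfbl_app: "dfbl (\<lambda>v. P (v 0)) \<Longrightarrow> dtm t \<Longrightarrow> dfbl (\<lambda>v. P (t v))"
  by (rule dfbl_subst[of "\<lambda>x v. P x"])

lemma mem_pair: "x \<in>\<^sub>M coll E {a, b} \<longleftrightarrow> x = a \<or> x = b"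
proof -
  have "is_set E {a, b}" using ZF by (simp add: ZF_def)
  then show ?thesis by (simp add: mem_coll)
qed

lemma mem_singleton: "x \<in>\<^sub>M coll E {a} \<longleftrightarrow> x = a"
  using mem_pair[of x a a] by simp

lemma mem_pow [simp]: "x \<in>\<^sub>M pow E a \<longleftrightarrow> (\<forall>z. z \<in>\<^sub>M x \<longrightarrow> z \<in>\<^sub>M a)"
proof -
  have "is_set E {b. ext E b \<subseteq> ext E a}" using ZF by (simp add: ZF_def)
  then show ?thesis by (auto simp: mem_coll pow_def)
qed

definition union :: "'m \<Rightarrow> 'm" where
  "union a = coll E {x. \<exists>y. y \<in>\<^sub>M a \<and> x \<in>\<^sub>M y}"

lemma mem_union [simp]: "x \<in>\<^sub>M union a \<longleftrightarrow> (\<exists>y. y \<in>\<^sub>M a \<and> x \<in>\<^sub>M y)"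
proof -
  have "is_set E (\<Union>x\<in>ext E a. ext E x)" using ZF by (simp add: ZF_def)
  moreover have "(\<Union>x\<in>ext E a. ext E x) = {x. \<exists>y. y \<in>\<^sub>M a \<and> x \<in>\<^sub>M y}" by auto
  ultimately show ?thesis by (simp add: mem_coll union_def)
qed

lemma mem_cup [simp]: "x \<in>\<^sub>M cup E a b \<longleftrightarrow> x \<in>\<^sub>M a \<or> x \<in>\<^sub>M b"
proof -
  have "is_set E (ext E a \<union> ext E b)"
    unfolding is_set_def by (rule exI[of _ "union (coll E {a, b})"]) (auto simp: mem_pair)
  then show ?thesis by (simp add: mem_coll cup_def)
qed

lemma cup_commute: "cup E a b = cup E b a"
  by (rule extensionality) auto

lemma mem_succ [simp]: "x \<in>\<^sub>M succ E a \<longleftrightarrow> x = a \<or> x \<in>\<^sub>M a"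
proof -
  have "is_set E (insert a (ext E a))"
    unfolding is_set_def by (rule exI[of _ "cup E a (coll E {a})"]) (auto simp: mem_singleton)
  then show ?thesis by (simp add: mem_coll succ_def)
qed

definition zero :: 'm where
  "zero = coll E {}"

lemma mem_zero [simp]: "\<not> x \<in>\<^sub>M zero"
proof -
  have "is_set E {x. False}" by (rule is_set_subclass) (auto intro: dfb)
  then show ?thesis by (simp add: mem_coll zero_def)
qed

lemma opair_eq [simp]: "opair E a b = opair E c d \<longleftrightarrow> a = c \<and> b = d"
proof
  assume "opair E a b = opair E c d"
  then have *: "\<And>x. x \<in>\<^sub>M opair E a b \<longleftrightarrow> x \<in>\<^sub>M opair E c d" by simp
  have "x \<in>\<^sub>M opair E a b \<longleftrightarrow> (\<forall>z. z \<in>\<^sub>M x \<longleftrightarrow> z = a) \<or> (\<forall>z. z \<in>\<^sub>M x \<longleftrightarrow> z = a \<or> z = b)" for x a b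
    unfolding opair_def mem_pair
    by (metis extensionality mem_pair mem_singleton)
  then have "(\<forall>z. z \<in>\<^sub>M x \<longleftrightarrow> z = a) \<or> (\<forall>z. z \<in>\<^sub>M x \<longleftrightarrow> z = a \<or> z = b) \<longleftrightarrow>
     (\<forall>z. z \<in>\<^sub>M x \<longleftrightarrow> z = c) \<or> (\<forall>z. z \<in>\<^sub>M x \<longleftrightarrow> z = c \<or> z = d)" for x using * by simp
  from this[of "coll E {a}"] this[of "coll E {a, b}"] this[of "coll E {c}"] this[of "coll E {c, d}"]
  show "a = c \<and> b = d" unfolding mem_pair mem_singleton by metis
qed auto

lemma dtm_opair [dfb]:
  assumes "dtm t" "dtm s"
  shows "dtm (\<lambda>v. opair E (t v) (s v))"
proof -
  have "dtm (\<lambda>v. coll E {x. x = coll E {z. z = t v} \<or> x = coll E {z. z = t v \<or> z = s v}})"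
    by (intro dfb dtm_reindex[OF assms(1)] dtm_reindex[OF assms(2)])
  moreover have "{x. x = a \<or> x = b} = {a, b}" "{x. x = a} = {a}" for a b :: 'm by auto
  ultimately show ?thesis by (simp add: opair_def)
qed

lemma dtm_cup [dfb]: "dtm t \<Longrightarrow> dtm s \<Longrightarrow> dtm (\<lambda>v. cup E (t v) (s v))"
proof (rule dtm_app2[of "cup E"])
  show "dtm (\<lambda>v. cup E (v 0) (v 1))" unfolding cup_def Un_def ext_def mem_Collect_eq
    by (intro dfb)
qed

lemma dtm_succ [dfb]: "dtm t \<Longrightarrow> dtm (\<lambda>v. succ E (t v))"
proof (rule dtm_app[of "succ E"])
  show "dtm (\<lambda>v. succ E (v 0))" unfolding succ_def insert_def Un_def ext_def mem_Collect_eq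
    by (intro dfb)
qed

lemma mem_cprod: "z \<in>\<^sub>M cprod E a b \<longleftrightarrow> (\<exists>x y. z = opair E x y \<and> x \<in>\<^sub>M a \<and> y \<in>\<^sub>M b)"
proof -
  have "is_set E {z. \<exists>x y. z = opair E x y \<and> x \<in>\<^sub>M a \<and> y \<in>\<^sub>M b}"
    by (rule is_set_subclass[where a = "pow E (pow E (cup E a b))"], intro dfb)
      (auto simp: opair_def mem_pair mem_singleton)
  then show ?thesis by (simp add: mem_coll cprod_def)
qed

lemma opair_mem_cprod [simp]: "opair E x y \<in>\<^sub>M cprod E a b \<longleftrightarrow> x \<in>\<^sub>M a \<and> y \<in>\<^sub>M b"
  by (auto simp: mem_cprod)

lemma dtm_cprod [dfb]: "dtm t \<Longrightarrow> dtm s \<Longrightarrow> dtm (\<lambda>v. cprod E (t v) (s v))"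
  by (rule dtm_app2[of "cprod E"]) (unfold cprod_def, intro dfb)

text \<open>The component is recovered as the set of its own elements, so that the closure rule for
  \<open>coll\<close> gives definability. On an individual that is not a pair the result is
  empty.\<close>

definition pfst :: "'m \<Rightarrow> 'm" where
  "pfst p = coll E {z. \<exists>x y. p = opair E x y \<and> z \<in>\<^sub>M x}"

definition psnd :: "'m \<Rightarrow> 'm" where
  "psnd p = coll E {z. \<exists>x y. p = opair E x y \<and> z \<in>\<^sub>M y}"

lemma pfst_opair [simp]: "pfst (opair E x y) = x"
  by (simp add: pfst_def)

lemma psnd_opair [simp]: "psnd (opair E x y) = y"
  by (simp add: psnd_def)

lemma dtm_pfst [dfb]: "dtm t \<Longrightarrow> dtm (\<lambda>v. pfst (t v))"
  by (rule dtm_app[of pfst]) (unfold pfst_def, intro dfb)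

lemma dtm_psnd [dfb]: "dtm t \<Longrightarrow> dtm (\<lambda>v. psnd (t v))"
  by (rule dtm_app[of psnd]) (unfold psnd_def, intro dfb)

lemma foundation:
  assumes "dfbl (\<lambda>v. P (v 0))" "x \<in>\<^sub>M a" "P x"
  obtains m where "m \<in>\<^sub>M a" "P m" "\<And>y. y \<in>\<^sub>M m \<Longrightarrow> y \<in>\<^sub>M a \<Longrightarrow> \<not> P y"
proof -
  let ?b = "coll E {x. x \<in>\<^sub>M a \<and> P x}"
  have b: "z \<in>\<^sub>M ?b \<longleftrightarrow> z \<in>\<^sub>M a \<and> P z" for z using dfbl_separation[OF assms(1)] by (simp add: mem_coll)
  then have "ext E ?b \<noteq> {}" using assms(2,3) by (metis empty_iff mem_ext)
  then obtain m where "m \<in>\<^sub>M ?b" "ext E m \<inter> ext E ?b = {}" using ZF unfolding ZF_def by (metis mem_ext)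
  then show ?thesis using b by (intro that[of m]) (auto simp: set_eq_iff)
qed

lemma mem_irrefl: "\<not> a \<in>\<^sub>M a"
proof
  assume "a \<in>\<^sub>M a"
  obtain m where "m \<in>\<^sub>M coll E {a}" "\<And>y. y \<in>\<^sub>M m \<Longrightarrow> y \<in>\<^sub>M coll E {a} \<Longrightarrow> \<not> True"
    by (rule foundation[of "\<lambda>_. True" a "coll E {a}"]) (auto simp: mem_singleton dfbl_const)
  with \<open>a \<in>\<^sub>M a\<close> show False by (auto simp: mem_singleton)
qed

lemma mem_asym: "a \<in>\<^sub>M b \<Longrightarrow> \<not> b \<in>\<^sub>M a"
proof
  assume ab: "a \<in>\<^sub>M b" "b \<in>\<^sub>M a"
  obtain m where "m \<in>\<^sub>M coll E {a, b}" "\<And>y. y \<in>\<^sub>M m \<Longrightarrow> y \<in>\<^sub>M coll E {a, b} \<Longrightarrow> \<not> True"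
    by (rule foundation[of "\<lambda>_. True" a "coll E {a, b}"]) (auto simp: mem_pair dfbl_const)
  with ab show False by (auto simp: mem_pair)
qed

lemma succ_inj [simp]: "succ E a = succ E b \<longleftrightarrow> a = b"
  by (metis mem_asym mem_succ)


section \<open>Natural numbers and embeddings\<close>

lemma is_inductive_iff:
  "is_inductive E a \<longleftrightarrow> zero \<in>\<^sub>M a \<and> (\<forall>x. x \<in>\<^sub>M a \<longrightarrow> succ E x \<in>\<^sub>M a)"
proof -
  have "ext E z = {} \<longleftrightarrow> z = zero" for z
    unfolding set_eq_iff eq_iff_members[of z zero] by simp
  moreover have "ext E y = insert x (ext E x) \<longleftrightarrow> y = succ E x" for x y
    unfolding set_eq_iff eq_iff_members[of y "succ E x"] by simp
  ultimately show ?thesis by (simp add: is_inductive_def Bex_def Ball_def)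
qed

lemma mem_omega: "n \<in>\<^sub>M omega E \<longleftrightarrow> (\<forall>a. is_inductive E a \<longrightarrow> n \<in>\<^sub>M a)"
proof -
  obtain a where a: "is_inductive E a" using ZF unfolding ZF_def by blast
  have "is_set E {n. \<forall>a. is_inductive E a \<longrightarrow> n \<in>\<^sub>M a}"
    unfolding is_inductive_iff
    by (rule is_set_subclass[where a = a], intro dfb) (use a[unfolded is_inductive_iff] in blast)
  then show ?thesis by (simp add: mem_coll omega_def)
qed

lemma zero_mem_omega [simp]: "zero \<in>\<^sub>M omega E"
  by (simp add: mem_omega is_inductive_iff)

lemma succ_mem_omega [simp]: "n \<in>\<^sub>M omega E \<Longrightarrow> succ E n \<in>\<^sub>M omega E"
  by (auto simp: mem_omega is_inductive_iff)

lemma omega_induct [consumes 1, case_names definable zero succ]: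
  assumes "n \<in>\<^sub>M omega E" "dfbl (\<lambda>v. P (v 0))" "P zero"
    "\<And>n. n \<in>\<^sub>M omega E \<Longrightarrow> P n \<Longrightarrow> P (succ E n)"
  shows "P n"
proof -
  let ?b = "coll E {x. x \<in>\<^sub>M omega E \<and> P x}"
  have b: "z \<in>\<^sub>M ?b \<longleftrightarrow> z \<in>\<^sub>M omega E \<and> P z" for z
    using dfbl_separation[OF assms(2)] by (simp add: mem_coll)
  have "is_inductive E ?b" unfolding is_inductive_iff b using assms(3,4) by simp
  then have "n \<in>\<^sub>M ?b" using assms(1) mem_omega by blast
  then show ?thesis using b by blast
qed

text \<open>Injections are definable class functions, so that they compose as terms; their values
  outside \<open>a\<close> are arbitrary.\<close>

definition emb :: "'m \<Rightarrow> 'm \<Rightarrow> bool" where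
  "emb a b \<longleftrightarrow> (\<exists>F. dtm (\<lambda>v. F (v 0)) \<and> (\<forall>x. x \<in>\<^sub>M a \<longrightarrow> F x \<in>\<^sub>M b) \<and> inj_on F (ext E a))"

lemma embI:
  assumes "dtm (\<lambda>v. F (v 0))" "\<And>x. x \<in>\<^sub>M a \<Longrightarrow> F x \<in>\<^sub>M b"
    "\<And>x y. x \<in>\<^sub>M a \<Longrightarrow> y \<in>\<^sub>M a \<Longrightarrow> F x = F y \<Longrightarrow> x = y"
  shows "emb a b"
  unfolding emb_def using assms by (intro exI[of _ F]) (auto simp: inj_on_def)

lemma embE:
  assumes "emb a b"
  obtains F where "dtm (\<lambda>v. F (v 0))" "\<And>x. x \<in>\<^sub>M a \<Longrightarrow> F x \<in>\<^sub>M b"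
    "\<And>x y. x \<in>\<^sub>M a \<Longrightarrow> y \<in>\<^sub>M a \<Longrightarrow> F x = F y \<Longrightarrow> x = y"
proof -
  obtain F where "dtm (\<lambda>v. F (v 0)) \<and> (\<forall>x. x \<in>\<^sub>M a \<longrightarrow> F x \<in>\<^sub>M b) \<and> inj_on F (ext E a)"
    using assms unfolding emb_def by (rule exE)
  then show ?thesis by (intro that[of F]) (auto simp: inj_on_def)
qed

lemma emb_subset: "(\<And>x. x \<in>\<^sub>M a \<Longrightarrow> x \<in>\<^sub>M b) \<Longrightarrow> emb a b"
  by (rule embI[of "\<lambda>x. x"]) (auto intro: dfb)

lemma emb_trans:
  assumes "emb a b" "emb b c"
  shows "emb a c"
proof -
  obtain F where F: "dtm (\<lambda>v. F (v 0))" "\<And>x. x \<in>\<^sub>M a \<Longrightarrow> F x \<in>\<^sub>M b"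
    "\<And>x y. x \<in>\<^sub>M a \<Longrightarrow> y \<in>\<^sub>M a \<Longrightarrow> F x = F y \<Longrightarrow> x = y" using assms(1) by (rule embE) blast
  obtain G where G: "dtm (\<lambda>v. G (v 0))" "\<And>x. x \<in>\<^sub>M b \<Longrightarrow> G x \<in>\<^sub>M c"
    "\<And>x y. x \<in>\<^sub>M b \<Longrightarrow> y \<in>\<^sub>M b \<Longrightarrow> G x = G y \<Longrightarrow> x = y" using assms(2) by (rule embE) blast
  show ?thesis
    by (rule embI[of "\<lambda>x. G (F x)"]) (use F G dtm_app[OF G(1) F(1)] in blast)+
qed

text \<open>
  For the function with graph \<open>R\<close>, the union of the values \<open>y\<close> with \<open>R x y\<close> serves as a definable
  term, since there is only one such value.
\<close>

lemma embI_rel: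
  assumes "dfbl (\<lambda>v. R (v 0) (v 1))" "\<And>x. x \<in>\<^sub>M a \<Longrightarrow> \<exists>y. y \<in>\<^sub>M b \<and> R x y"
    "\<And>x y y'. x \<in>\<^sub>M a \<Longrightarrow> R x y \<Longrightarrow> R x y' \<Longrightarrow> y = y'"
    "\<And>x x' y. x \<in>\<^sub>M a \<Longrightarrow> x' \<in>\<^sub>M a \<Longrightarrow> R x y \<Longrightarrow> R x' y \<Longrightarrow> x = x'"
  shows "emb a b"
proof -
  let ?F = "\<lambda>x. coll E {z. \<exists>y. R x y \<and> z \<in>\<^sub>M y}"
  have F: "?F x = y" if "x \<in>\<^sub>M a" "R x y" for x y
  proof -
    have "(\<exists>y. R x y \<and> z \<in>\<^sub>M y) \<longleftrightarrow> z \<in>\<^sub>M y" for z using assms(3) that by blast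
    then show ?thesis by simp
  qed
  have "dfbl (\<lambda>v. R (v 2) (v 0))" using dfbl_reindex[OF assms(1), of "\<lambda>i. 2 - 2 * i"] by simp
  then have d: "dtm (\<lambda>v. ?F (v 0))" by (intro dfb) (simp add: numeral_2_eq_2)
  show ?thesis
  proof (rule embI[OF d])
    show "?F x \<in>\<^sub>M b" if "x \<in>\<^sub>M a" for x using assms(2)[OF that] F that by auto
    show "x = y" if "x \<in>\<^sub>M a" "y \<in>\<^sub>M a" "?F x = ?F y" for x y
      using assms(2)[OF that(1)] assms(2)[OF that(2)] F that assms(4) by metis
  qed
qed

text \<open>By replacement the graph of a definable injection is a set of the structure; conversely
  a graph may serve as a parameter. Quantifying over graphs instead of HOL functions makes
  \<open>emb\<close> first-order, so that induction can be applied to statements about it.\<close>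

lemma emb_iff:
  "emb a b \<longleftrightarrow> (\<exists>f. (\<forall>x. x \<in>\<^sub>M a \<longrightarrow> (\<exists>y. y \<in>\<^sub>M b \<and> opair E x y \<in>\<^sub>M f)) \<and>
     (\<forall>x y y'. opair E x y \<in>\<^sub>M f \<longrightarrow> opair E x y' \<in>\<^sub>M f \<longrightarrow> y = y') \<and>
     (\<forall>x x' y. opair E x y \<in>\<^sub>M f \<longrightarrow> opair E x' y \<in>\<^sub>M f \<longrightarrow> x = x'))" (is "_ \<longleftrightarrow> ?R")
proof
  assume "emb a b"
  then obtain F where F: "dtm (\<lambda>v. F (v 0))" "\<And>x. x \<in>\<^sub>M a \<Longrightarrow> F x \<in>\<^sub>M b"
    "\<And>x y. x \<in>\<^sub>M a \<Longrightarrow> y \<in>\<^sub>M a \<Longrightarrow> F x = F y \<Longrightarrow> x = y" by (rule embE) blast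
  let ?f = "coll E {p. \<exists>x. x \<in>\<^sub>M a \<and> p = opair E x (F x)}"
  have "dtm (\<lambda>v. opair E (v 0) (F (v 0)))" by (intro dfb F(1))
  then have f: "p \<in>\<^sub>M ?f \<longleftrightarrow> (\<exists>x. x \<in>\<^sub>M a \<and> p = opair E x (F x))" for p
    using is_set_image[of "\<lambda>x. opair E x (F x)"] by (simp add: mem_coll)
  show ?R by (rule exI[of _ ?f]) (use F(2,3) in \<open>auto simp: f\<close>)
next
  assume ?R
  then obtain f where f: "\<And>x. x \<in>\<^sub>M a \<Longrightarrow> (\<exists>y. y \<in>\<^sub>M b \<and> opair E x y \<in>\<^sub>M f)"
    "\<And>x y y'. opair E x y \<in>\<^sub>M f \<Longrightarrow> opair E x y' \<in>\<^sub>M f \<Longrightarrow> y = y'"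
    "\<And>x x' y. opair E x y \<in>\<^sub>M f \<Longrightarrow> opair E x' y \<in>\<^sub>M f \<Longrightarrow> x = x'" by blast
  show "emb a b"
    by (rule embI_rel[of "\<lambda>x y. opair E x y \<in>\<^sub>M f"], intro dfb) (erule f(1), (erule (1) f(2,3))+)
qed

lemma dfbl_emb [dfb]: "dtm t \<Longrightarrow> dtm s \<Longrightarrow> dfbl (\<lambda>v. emb (t v) (s v))"
  by (rule dfbl_subst2[of emb]) (unfold emb_iff, intro dfb)

lemma emb_cprod:
  assumes "emb a c" "emb b d"
  shows "emb (cprod E a b) (cprod E c d)"
proof -
  obtain F where F: "dtm (\<lambda>v. F (v 0))" "\<And>x. x \<in>\<^sub>M a \<Longrightarrow> F x \<in>\<^sub>M c"
    "\<And>x y. x \<in>\<^sub>M a \<Longrightarrow> y \<in>\<^sub>M a \<Longrightarrow> F x = F y \<Longrightarrow> x = y" using assms(1) by (rule embE) blast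
  obtain G where G: "dtm (\<lambda>v. G (v 0))" "\<And>x. x \<in>\<^sub>M b \<Longrightarrow> G x \<in>\<^sub>M d"
    "\<And>x y. x \<in>\<^sub>M b \<Longrightarrow> y \<in>\<^sub>M b \<Longrightarrow> G x = G y \<Longrightarrow> x = y" using assms(2) by (rule embE) blast
  have "dtm (\<lambda>v. opair E (F (pfst (v 0))) (G (psnd (v 0))))"
    by (intro dfb dtm_app[OF F(1)] dtm_app[OF G(1)])
  then show ?thesis
    by (rule embI[of "\<lambda>p. opair E (F (pfst p)) (G (psnd p))"])
      (use F G in \<open>auto simp: mem_cprod\<close>)
qed

text \<open>Hilbert's hotel: the shifted map \<open>F (succ E n)\<close> leaves the value
  \<open>F zero\<close> free, and this value replaces \<open>c\<close> if \<open>c\<close> is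
  hit.\<close>

lemma emb_omega_insert:
  assumes "emb (omega E) (cup E a (coll E {c}))"
  shows "emb (omega E) a"
proof -
  obtain F where F: "dtm (\<lambda>v. F (v 0))" "\<And>x. x \<in>\<^sub>M omega E \<Longrightarrow> F x \<in>\<^sub>M cup E a (coll E {c})"
    "\<And>x y. x \<in>\<^sub>M omega E \<Longrightarrow> y \<in>\<^sub>M omega E \<Longrightarrow> F x = F y \<Longrightarrow> x = y" using assms by (rule embE) blast
  let ?G = "\<lambda>n. if F (succ E n) = c then F zero else F (succ E n)"
  have G: "dtm (\<lambda>v. ?G (v 0))" by (intro dfb dtm_app[OF F(1)])
  have z: "succ E n \<noteq> zero" for n using mem_zero[of n] by (metis mem_succ)
  show ?thesis
  proof (rule embI[OF G])
    fix n assume n: "n \<in>\<^sub>M omega E"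
    show "?G n \<in>\<^sub>M a"
      using F(2)[of "succ E n"] F(2)[of zero] F(3)[of "succ E n" zero] z n
      by (auto simp: mem_singleton)
  next
    fix n m assume "n \<in>\<^sub>M omega E" "m \<in>\<^sub>M omega E" "?G n = ?G m"
    then show "n = m" using F(3)[of "succ E n" "succ E m"] F(3)[of "succ E n" zero]
        F(3)[of "succ E m" zero] z by (auto split: if_splits)
  qed
qed

text \<open>Finite sets are presented as definable images of a natural number, so that the points
  can be removed one at a time by induction on \<open>n\<close>.\<close>

lemma emb_omega_cup_image:
  assumes F: "dtm (\<lambda>v. F (v 0))" and n: "n \<in>\<^sub>M omega E"
    and "emb (omega E) (cup E a (coll E {y. \<exists>k. k \<in>\<^sub>M n \<and> y = F k}))"
  shows "emb (omega E) a"
proof -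
  have im: "y \<in>\<^sub>M coll E {y. \<exists>k. k \<in>\<^sub>M n \<and> y = F k} \<longleftrightarrow> (\<exists>k. k \<in>\<^sub>M n \<and> y = F k)" for y n
    using is_set_image[OF F] by (simp add: mem_coll)
  from n have "emb (omega E) (cup E a (coll E {y. \<exists>k. k \<in>\<^sub>M n \<and> y = F k})) \<longrightarrow> emb (omega E) a"
  proof (induction n rule: omega_induct)
    case definable
    show ?case by (intro dfb dtm_app[OF F])
  next
    case zero
    have "cup E a (coll E {y. \<exists>k. k \<in>\<^sub>M zero \<and> y = F k}) = a"
      by (rule extensionality) (simp flip: zero_def)
    then show ?case by metis
  next
    case (succ n)
    have eq: "cup E a (coll E {y. \<exists>k. k \<in>\<^sub>M succ E n \<and> y = F k}) =
        cup E (cup E a (coll E {y. \<exists>k. k \<in>\<^sub>M n \<and> y = F k})) (coll E {F n})"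
      by (rule extensionality) (unfold mem_cup im mem_singleton, unfold mem_succ, blast)
    show ?case unfolding eq using succ.IH emb_omega_insert by blast
  qed
  with assms(3) show ?thesis by blast
qed

text \<open>Passing from \<open>m\<close> to its successor adds a single row, the image of
  \<open>n\<close> under pairing with \<open>m\<close>, and such an image can be removed.\<close>

lemma emb_omega_cprod:
  assumes n: "n \<in>\<^sub>M omega E" and "m \<in>\<^sub>M omega E"
  shows "\<not> emb (omega E) (cprod E n m)"
  using assms(2)
proof (induction m rule: omega_induct)
  case definable
  show ?case by (intro dfb)
next
  case zero
  have "\<not> x \<in>\<^sub>M cprod E n zero" for x by (simp add: mem_cprod)
  then show ?case unfolding emb_def using zero_mem_omega by blast
next
  case (succ m)
  have F: "dtm (\<lambda>v. opair E (v 0) m)" by (intro dfb)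
  have eq: "cprod E n (succ E m) = cup E (cprod E n m) (coll E {y. \<exists>k. k \<in>\<^sub>M n \<and> y = opair E k m})"
    using is_set_image[OF F] by (intro extensionality) (auto simp: mem_coll mem_cprod)
  show ?case unfolding eq using emb_omega_cup_image[OF F n] succ.IH by blast
qed

end

context zf_model
begin

section \<open>Ordinals\<close>

lemma transitive_iff: "transitive E a \<longleftrightarrow> (\<forall>x y. x \<in>\<^sub>M a \<longrightarrow> y \<in>\<^sub>M x \<longrightarrow> y \<in>\<^sub>M a)"
  unfolding transitive_def subset_iff Ball_def mem_ext by blast

lemma dfbl_ordinal [dfb]: "dtm t \<Longrightarrow> dfbl (\<lambda>v. ordinal E (t v))"
  by (rule dfbl_app[of "ordinal E"]) (unfold ordinal_def transitive_iff Ball_def mem_ext, intro dfb)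

lemma ordinal_trans: "ordinal E a \<Longrightarrow> x \<in>\<^sub>M a \<Longrightarrow> y \<in>\<^sub>M x \<Longrightarrow> y \<in>\<^sub>M a"
  unfolding ordinal_def transitive_iff by blast

lemma ordinal_mem: "ordinal E a \<Longrightarrow> x \<in>\<^sub>M a \<Longrightarrow> ordinal E x"
  unfolding ordinal_def transitive_iff Ball_def mem_ext by blast

lemma ordinalI:
  "(\<And>x y. x \<in>\<^sub>M a \<Longrightarrow> y \<in>\<^sub>M x \<Longrightarrow> y \<in>\<^sub>M a) \<Longrightarrow> (\<And>x. x \<in>\<^sub>M a \<Longrightarrow> ordinal E x) \<Longrightarrow> ordinal E a"
  unfolding ordinal_def transitive_iff Ball_def mem_ext by blast

lemma ordinal_induct [consumes 1, case_names definable step]: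
  assumes "ordinal E a" and d: "dfbl (\<lambda>v. P (v 0))"
    and step: "\<And>a. ordinal E a \<Longrightarrow> (\<And>b. b \<in>\<^sub>M a \<Longrightarrow> P b) \<Longrightarrow> P a"
  shows "P a"
proof (rule ccontr)
  assume n: "\<not> P a"
  have d': "dfbl (\<lambda>v. \<not> P (v 0))" by (intro dfb d)
  \<comment> \<open>Foundation needs a set that contains the counterexample \<open>a\<close> itself.
    The successor of \<open>a\<close> is also transitive, so a minimal counterexample in it has none
    among all its elements.\<close>
  have "a \<in>\<^sub>M succ E a" by simp
  then obtain m where m: "m \<in>\<^sub>M succ E a" "\<not> P m" "\<And>y. y \<in>\<^sub>M m \<Longrightarrow> y \<in>\<^sub>M succ E a \<Longrightarrow> \<not> \<not> P y"
    by (rule foundation[of "\<lambda>x. \<not> P x" a "succ E a", OF d' _ n]) blast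
  have "y \<in>\<^sub>M succ E a" if "y \<in>\<^sub>M m" for y
    using m(1) that ordinal_trans[OF assms(1)] by auto
  moreover have "ordinal E m" using m(1) assms(1) ordinal_mem by auto
  ultimately show False using step m(2,3) by blast
qed

lemma ordinal_linear:
  assumes "ordinal E a" "ordinal E b"
  shows "a \<in>\<^sub>M b \<or> a = b \<or> b \<in>\<^sub>M a"
proof -
  from assms(1) have "\<forall>b. ordinal E b \<longrightarrow> a \<in>\<^sub>M b \<or> a = b \<or> b \<in>\<^sub>M a"
  proof (induction a rule: ordinal_induct)
    case definable
    show ?case by (intro dfb)
  next
    case (step a)
    show ?case
    proof (intro allI impI)
      fix b assume "ordinal E b"
      then show "a \<in>\<^sub>M b \<or> a = b \<or> b \<in>\<^sub>M a"
      proof (induction b rule: ordinal_induct)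
        case definable
        show ?case by (intro dfb)
      next
        case (step b)
        note IH1 = \<open>\<And>c. c \<in>\<^sub>M a \<Longrightarrow> \<forall>b. ordinal E b \<longrightarrow> c \<in>\<^sub>M b \<or> c = b \<or> b \<in>\<^sub>M c\<close>
        show ?case
        proof (rule ccontr)
          assume n: "\<not> ?case"
          have "x \<in>\<^sub>M a \<longleftrightarrow> x \<in>\<^sub>M b" for x
          proof
            assume x: "x \<in>\<^sub>M a"
            then have "x \<in>\<^sub>M b \<or> x = b \<or> b \<in>\<^sub>M x" using IH1 step.hyps by blast
            then show "x \<in>\<^sub>M b" using n x ordinal_trans[OF \<open>ordinal E a\<close>] by blast
          next
            assume x: "x \<in>\<^sub>M b"
            then have "a \<in>\<^sub>M x \<or> a = x \<or> x \<in>\<^sub>M a" using step.IH by blast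
            then show "x \<in>\<^sub>M a" using n x ordinal_trans[OF step.hyps] by blast
          qed
          then have "a = b" by (rule extensionality)
          with n show False by blast
        qed
      qed
    qed
  qed
  with assms(2) show ?thesis by blast
qed

lemma ordinal_succ: "ordinal E a \<Longrightarrow> ordinal E (succ E a)"
  by (rule ordinalI) (auto intro: ordinal_mem ordinal_trans)

lemma ordinal_nat:
  assumes "n \<in>\<^sub>M omega E"
  shows "ordinal E n"
  using assms
proof (induction n rule: omega_induct)
  case definable
  show ?case by (intro dfb)
next
  case zero
  show ?case by (rule ordinalI) simp_all
qed (rule ordinal_succ)

lemma omega_transitive:
  assumes "n \<in>\<^sub>M omega E"
  shows "\<forall>k. k \<in>\<^sub>M n \<longrightarrow> k \<in>\<^sub>M omega E"
  using assms
proof (induction n rule: omega_induct)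
  case definable
  show ?case by (intro dfb)
qed auto

lemma ordinal_omega: "ordinal E (omega E)"
  by (rule ordinalI) (use omega_transitive ordinal_nat in blast)+

lemma ordinal_finite_or_infinite:
  assumes "ordinal E a"
  obtains "a \<in>\<^sub>M omega E" | "\<And>n. n \<in>\<^sub>M omega E \<Longrightarrow> n \<in>\<^sub>M a"
  using ordinal_linear[OF assms ordinal_omega] ordinal_trans[OF assms] by blast

lemma emb_omega_nat: "n \<in>\<^sub>M omega E \<Longrightarrow> \<not> emb (omega E) n"
proof
  assume n: "n \<in>\<^sub>M omega E" "emb (omega E) n"
  have "emb n (cprod E n (succ E zero))"
    by (rule embI[of "\<lambda>x. opair E x zero"], intro dfb) auto
  then show False using n emb_omega_cprod[OF n(1), of "succ E zero"] emb_trans by simp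
qed

text \<open>The hotel once more: the new point \<open>m\<close> goes to 0, the natural numbers move
  up by one, and the other elements stay.\<close>

lemma emb_succ:
  assumes "ordinal E m" and "\<And>n. n \<in>\<^sub>M omega E \<Longrightarrow> n \<in>\<^sub>M m"
  shows "emb (succ E m) m"
proof -
  let ?F = "\<lambda>x. if x = m then zero else if x \<in>\<^sub>M omega E then succ E x else x"
  have d: "dtm (\<lambda>v. ?F (v 0))" by (intro dfb)
  have z: "succ E n \<noteq> zero" for n using mem_zero[of n] by (metis mem_succ)
  have m: "\<not> m \<in>\<^sub>M omega E" using assms(2) mem_irrefl by blast
  show ?thesis
  proof (rule embI[OF d])
    show "?F x \<in>\<^sub>M m" if "x \<in>\<^sub>M succ E m" for x using that assms(2) by auto
    show "x = y" if "x \<in>\<^sub>M succ E m" "y \<in>\<^sub>M succ E m" "?F x = ?F y" for x y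
    proof -
      have "\<not> x \<in>\<^sub>M omega E \<Longrightarrow> x \<noteq> zero \<and> (\<forall>n. n \<in>\<^sub>M omega E \<longrightarrow> x \<noteq> succ E n)" for x
        by auto
      from this[of x] this[of y] show ?thesis using that(3) z z[symmetric] by (auto split: if_splits)
    qed
  qed
qed

end


section \<open>Collapse of a definable well-order\<close>

text \<open>Well-foundedness is an induction scheme for definable predicates only: in an ill-founded
  structure the relation may have infinite descending sequences when seen from outside.\<close>

locale definable_wellorder = zf_model E for E :: "'m \<Rightarrow> 'm \<Rightarrow> bool" (infix "\<in>\<^sub>M" 50) +
  fixes X :: 'm and R :: "'m \<Rightarrow> 'm \<Rightarrow> bool"
  assumes dfbl_R: "dfbl (\<lambda>v. R (v 0) (v 1))"
    and trans_R: "\<And>x y z. x \<in>\<^sub>M X \<Longrightarrow> y \<in>\<^sub>M X \<Longrightarrow> z \<in>\<^sub>M X \<Longrightarrow> R x y \<Longrightarrow> R y z \<Longrightarrow> R x z"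
    and irrefl_R: "\<And>x. x \<in>\<^sub>M X \<Longrightarrow> \<not> R x x"
    and linear_R: "\<And>x y. x \<in>\<^sub>M X \<Longrightarrow> y \<in>\<^sub>M X \<Longrightarrow> x = y \<or> R x y \<or> R y x"
    and induct_R: "\<And>P z. z \<in>\<^sub>M X \<Longrightarrow> dfbl (\<lambda>v. P (v 0)) \<Longrightarrow>
      (\<And>z. z \<in>\<^sub>M X \<Longrightarrow> (\<And>w. w \<in>\<^sub>M X \<Longrightarrow> R w z \<Longrightarrow> P w) \<Longrightarrow> P z) \<Longrightarrow> P z"
begin

lemmas dfbl_R' = dfbl_subst2[OF dfbl_R]

text \<open>Approximations to the Mostowski collapse, which sends each point to the set of the
  values of its predecessors. Recursion is thereby replaced by a first-order condition on the set
  \<open>g\<close>. Nothing is required of \<open>g\<close> beyond the segment up to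
  \<open>z\<close>, so the same \<open>g\<close> serves every predecessor.\<close>

definition attempt_at :: "'m \<Rightarrow> 'm \<Rightarrow> bool" where
  "attempt_at z g \<longleftrightarrow> (\<forall>w. w \<in>\<^sub>M X \<and> (w = z \<or> R w z) \<longrightarrow>
     (\<exists>y. (\<forall>y'. opair E w y' \<in>\<^sub>M g \<longleftrightarrow> y' = y) \<and>
        (\<forall>u. u \<in>\<^sub>M y \<longleftrightarrow> (\<exists>v. v \<in>\<^sub>M X \<and> R v w \<and> opair E v u \<in>\<^sub>M g))))"

definition val :: "'m \<Rightarrow> 'm \<Rightarrow> bool" where
  "val z y \<longleftrightarrow> (\<exists>g. attempt_at z g \<and> opair E z y \<in>\<^sub>M g)"

lemma dfbl_attempt_at: "dtm t \<Longrightarrow> dtm s \<Longrightarrow> dfbl (\<lambda>v. attempt_at (t v) (s v))"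
  by (rule dfbl_subst2[of attempt_at]) (unfold attempt_at_def, intro dfb dfbl_R')

lemma dfbl_val: "dtm t \<Longrightarrow> dtm s \<Longrightarrow> dfbl (\<lambda>v. val (t v) (s v))"
  by (rule dfbl_subst2[of val]) (unfold val_def, intro dfb dfbl_attempt_at)

lemma attempt_at_unique:
  assumes "attempt_at z g" "z \<in>\<^sub>M X" "w \<in>\<^sub>M X" "w = z \<or> R w z" "opair E w y \<in>\<^sub>M g"
  shows "opair E w y' \<in>\<^sub>M g \<longleftrightarrow> y' = y" "u \<in>\<^sub>M y \<longleftrightarrow> (\<exists>v. v \<in>\<^sub>M X \<and> R v w \<and> opair E v u \<in>\<^sub>M g)"
proof -
  obtain y0 where y0: "\<forall>y'. opair E w y' \<in>\<^sub>M g \<longleftrightarrow> y' = y0"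
        "\<forall>u. u \<in>\<^sub>M y0 \<longleftrightarrow> (\<exists>v. v \<in>\<^sub>M X \<and> R v w \<and> opair E v u \<in>\<^sub>M g)"
    using assms unfolding attempt_at_def by blast
  with assms(5) have "y0 = y" by simp
  with y0 show "opair E w y' \<in>\<^sub>M g \<longleftrightarrow> y' = y" "u \<in>\<^sub>M y \<longleftrightarrow> (\<exists>v. v \<in>\<^sub>M X \<and> R v w \<and> opair E v u \<in>\<^sub>M g)"
    by blast+
qed

lemma attempt_at_ex:
  assumes "attempt_at z g" "w \<in>\<^sub>M X" "w = z \<or> R w z"
  shows "\<exists>y. opair E w y \<in>\<^sub>M g"
  using assms unfolding attempt_at_def by blast

lemma attempt_at_mono:
  "attempt_at z g \<Longrightarrow> z \<in>\<^sub>M X \<Longrightarrow> w \<in>\<^sub>M X \<Longrightarrow> R w z \<Longrightarrow> attempt_at w g"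
  unfolding attempt_at_def using trans_R by blast

text \<open>An approximation at \<open>z\<close> is one at each predecessor, so by induction two of
  them agree below \<open>z\<close>; the values below determine the value at
  \<open>z\<close>.\<close>

lemma val_unique:
  assumes "z \<in>\<^sub>M X" "val z y" "val z y'"
  shows "y = y'"
proof -
  let ?P = "\<lambda>z. \<forall>y y'. val z y \<longrightarrow> val z y' \<longrightarrow> y = y'"
  have d: "dfbl (\<lambda>v. ?P (v 0))" by (intro dfb dfbl_val)
  have "?P z"
  proof (rule induct_R[OF assms(1) d], intro allI impI)
    fix z y y' assume z: "z \<in>\<^sub>M X" and IH: "\<And>w. w \<in>\<^sub>M X \<Longrightarrow> R w z \<Longrightarrow> ?P w"
      and "val z y" "val z y'"
    then obtain g g' where g: "attempt_at z g" "opair E z y \<in>\<^sub>M g" and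
      g': "attempt_at z g'" "opair E z y' \<in>\<^sub>M g'" unfolding val_def by blast
    have sub: "opair E v u \<in>\<^sub>M h'"
      if h: "attempt_at z h" "attempt_at z h'" and v: "v \<in>\<^sub>M X" "R v z" "opair E v u \<in>\<^sub>M h" for h h' v u
    proof -
      obtain u' where u': "opair E v u' \<in>\<^sub>M h'" using attempt_at_ex h(2) v by blast
      have "val v u" "val v u'" unfolding val_def using attempt_at_mono h z v u' by blast+
      then have "u = u'" using IH v by blast
      with u' show ?thesis by simp
    qed
    show "y = y'"
    proof (rule extensionality)
      fix u
      show "u \<in>\<^sub>M y \<longleftrightarrow> u \<in>\<^sub>M y'"
        unfolding attempt_at_unique(2)[OF g(1) z z _ g(2), simplified]
          attempt_at_unique(2)[OF g'(1) z z _ g'(2), simplified]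
        using sub g(1) g'(1) by blast
    qed
  qed
  with assms(2,3) show ?thesis by blast
qed

lemma val_members:
  assumes "z \<in>\<^sub>M X" "val z y"
  shows "u \<in>\<^sub>M y \<longleftrightarrow> (\<exists>v. v \<in>\<^sub>M X \<and> R v z \<and> val v u)"
proof -
  obtain g where g: "attempt_at z g" "opair E z y \<in>\<^sub>M g" using assms unfolding val_def by blast
  have "opair E v u \<in>\<^sub>M g \<longleftrightarrow> val v u" if v: "v \<in>\<^sub>M X" "R v z" for v
  proof
    assume "opair E v u \<in>\<^sub>M g"
    then show "val v u" unfolding val_def using attempt_at_mono g assms v by blast
  next
    assume u: "val v u"
    obtain u' where u': "opair E v u' \<in>\<^sub>M g" using attempt_at_ex g v by blast
    then have "val v u'" unfolding val_def using attempt_at_mono g assms v by blast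
    then have "u' = u" using val_unique u v by blast
    with u' show "opair E v u \<in>\<^sub>M g" by simp
  qed
  then show ?thesis
    unfolding attempt_at_unique(2)[OF g(1) assms(1) assms(1) _ g(2), simplified] by blast
qed

lemma val_ex:
  assumes "z \<in>\<^sub>M X"
  shows "\<exists>y. val z y"
proof (rule induct_R[OF assms, where P = "\<lambda>z. \<exists>y. val z y"])
  show "dfbl (\<lambda>v. \<exists>y. val (v 0) y)" by (intro dfb dfbl_val)
next
  fix z assume z: "z \<in>\<^sub>M X" and IH: "\<And>w. w \<in>\<^sub>M X \<Longrightarrow> R w z \<Longrightarrow> \<exists>y. val w y"
  \<comment> \<open>The value forced at \<open>z\<close>. Replacement, based on uniqueness, makes it
    a set and does the same for the graph \<open>g\<close> of \<open>val\<close> below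
    \<open>z\<close> extended by the pair of \<open>z\<close> and this value.\<close>
  let ?y = "coll E {u. \<exists>w. w \<in>\<^sub>M X \<and> R w z \<and> val w u}"
  have "is_set E {u. \<exists>w. w \<in>\<^sub>M X \<and> R w z \<and> val w u}"
    by (rule dfbl_replacement, intro dfb dfbl_val dfbl_R') (use val_unique in blast)
  then have y: "u \<in>\<^sub>M ?y \<longleftrightarrow> (\<exists>w. w \<in>\<^sub>M X \<and> R w z \<and> val w u)" for u by (simp add: mem_coll)
  have "is_set E {p. \<exists>w. w \<in>\<^sub>M X \<and> (\<exists>u. (R w z \<and> val w u \<or> w = z \<and> u = ?y) \<and> p = opair E w u)}"
    by (rule dfbl_replacement, intro dfb dfbl_val dfbl_R') (use val_unique irrefl_R z in blast)
  then obtain g where "\<And>p. p \<in>\<^sub>M g \<longleftrightarrow>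
      (\<exists>w. w \<in>\<^sub>M X \<and> (\<exists>u. (R w z \<and> val w u \<or> w = z \<and> u = ?y) \<and> p = opair E w u))"
    using mem_coll by blast
  then have g: "opair E w u \<in>\<^sub>M g \<longleftrightarrow> w \<in>\<^sub>M X \<and> (R w z \<and> val w u \<or> w = z \<and> u = ?y)" for w u
    by simp
  have gR: "opair E w u \<in>\<^sub>M g \<longleftrightarrow> val w u" if "w \<in>\<^sub>M X" "R w z" for w u
    using g irrefl_R that by blast
  have "attempt_at z g" unfolding attempt_at_def
  proof (intro allI impI, elim conjE disjE)
    fix w assume w: "w = z"
    show "\<exists>y. (\<forall>y'. opair E w y' \<in>\<^sub>M g \<longleftrightarrow> y' = y) \<and>
        (\<forall>u. u \<in>\<^sub>M y \<longleftrightarrow> (\<exists>v. v \<in>\<^sub>M X \<and> R v w \<and> opair E v u \<in>\<^sub>M g))"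
    proof (intro exI[of _ ?y] conjI allI)
      show "opair E w y' \<in>\<^sub>M g \<longleftrightarrow> y' = ?y" for y' using g w z irrefl_R by blast
      show "u \<in>\<^sub>M ?y \<longleftrightarrow> (\<exists>v. v \<in>\<^sub>M X \<and> R v w \<and> opair E v u \<in>\<^sub>M g)" for u
        unfolding y w using gR by blast
    qed
  next
    fix w assume w: "w \<in>\<^sub>M X" "R w z"
    then obtain y where y: "val w y" using IH by blast
    show "\<exists>y. (\<forall>y'. opair E w y' \<in>\<^sub>M g \<longleftrightarrow> y' = y) \<and>
        (\<forall>u. u \<in>\<^sub>M y \<longleftrightarrow> (\<exists>v. v \<in>\<^sub>M X \<and> R v w \<and> opair E v u \<in>\<^sub>M g))"
    proof (intro exI[of _ y] conjI allI)
      show "opair E w y' \<in>\<^sub>M g \<longleftrightarrow> y' = y" for y' using gR[OF w] y val_unique[OF w(1)] by blast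
      show "u \<in>\<^sub>M y \<longleftrightarrow> (\<exists>v. v \<in>\<^sub>M X \<and> R v w \<and> opair E v u \<in>\<^sub>M g)" for u
        unfolding val_members[OF w(1) y] using gR trans_R w z by blast
    qed
  qed
  then show "\<exists>y. val z y" using g z unfolding val_def by blast
qed

text \<open>Collecting the values at the predecessors, instead of describing the unique
  \<open>y\<close> with \<open>val z y\<close>, makes the term definable by the closure
  rules.\<close>

definition collapse :: "'m \<Rightarrow> 'm" where
  "collapse z = coll E {u. \<exists>v. v \<in>\<^sub>M X \<and> R v z \<and> val v u}"

lemma val_collapse:
  assumes "z \<in>\<^sub>M X"
  shows "val z (collapse z)"
proof -
  obtain y where y: "val z y" using val_ex[OF assms] by blast
  then show ?thesis unfolding collapse_def val_members[OF assms y, symmetric] by simp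
qed

lemma dtm_collapse: "dtm (\<lambda>v. collapse (v 0))"
  unfolding collapse_def by (intro dfb dfbl_val dfbl_R')

lemma mem_collapse:
  assumes "z \<in>\<^sub>M X"
  shows "u \<in>\<^sub>M collapse z \<longleftrightarrow> (\<exists>v. v \<in>\<^sub>M X \<and> R v z \<and> u = collapse v)"
  unfolding val_members[OF assms val_collapse[OF assms]]
  using val_collapse val_unique by blast

lemma collapse_inj:
  assumes "z \<in>\<^sub>M X" "w \<in>\<^sub>M X" "collapse z = collapse w"
  shows "z = w"
proof -
  have "\<not> R z w" using assms mem_collapse[of w "collapse z"] mem_irrefl by auto
  moreover have "\<not> R w z" using assms mem_collapse[of z "collapse w"] mem_irrefl by auto
  ultimately show ?thesis using linear_R assms by blast
qed

lemma ordinal_collapse: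
  assumes "z \<in>\<^sub>M X"
  shows "ordinal E (collapse z)"
proof (rule induct_R[OF assms, where P = "\<lambda>z. ordinal E (collapse z)"])
  show "dfbl (\<lambda>v. ordinal E (collapse (v 0)))" by (rule dfbl_ordinal[OF dtm_collapse])
next
  fix z assume z: "z \<in>\<^sub>M X" and IH: "\<And>w. w \<in>\<^sub>M X \<Longrightarrow> R w z \<Longrightarrow> ordinal E (collapse w)"
  show "ordinal E (collapse z)"
  proof (rule ordinalI)
    fix x y assume x: "x \<in>\<^sub>M collapse z" "y \<in>\<^sub>M x"
    then obtain v where v: "v \<in>\<^sub>M X" "R v z" "x = collapse v" using mem_collapse[OF z] by auto
    then obtain w where w: "w \<in>\<^sub>M X" "R w v" "y = collapse w" using x(2) mem_collapse[OF v(1)] by auto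
    have "R w z" using trans_R[OF w(1) v(1) z] w v by simp
    then show "y \<in>\<^sub>M collapse z" using mem_collapse[OF z] w by auto
  next
    fix x assume "x \<in>\<^sub>M collapse z"
    then show "ordinal E x" using mem_collapse[OF z] IH by auto
  qed
qed

text \<open>Either all collapse values lie in \<open>a\<close>, and the collapse embeds
  \<open>X\<close>; or some \<open>collapse z\<close> is not in \<open>a\<close>. Then
  \<open>a\<close> is included in \<open>collapse z\<close>, whose elements are the collapses of the
  predecessors of \<open>z\<close>, and the inverse of the collapse embeds \<open>a\<close>.\<close>

lemma emb_ordinal_or_segment:
  assumes "ordinal E a"
  shows "emb X a \<or> (\<exists>z. z \<in>\<^sub>M X \<and> emb a (coll E {w. w \<in>\<^sub>M X \<and> R w z}))"
proof (cases "\<forall>z. z \<in>\<^sub>M X \<longrightarrow> collapse z \<in>\<^sub>M a")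
  case True
  have "emb X a" by (rule embI[OF dtm_collapse]) (use True in simp, erule (2) collapse_inj)
  then show ?thesis ..
next
  case False
  then obtain z where z: "z \<in>\<^sub>M X" "\<not> collapse z \<in>\<^sub>M a" by blast
  then have "a = collapse z \<or> a \<in>\<^sub>M collapse z" using ordinal_linear[OF assms ordinal_collapse] by blast
  then have sub: "b \<in>\<^sub>M collapse z" if "b \<in>\<^sub>M a" for b using that ordinal_trans[OF ordinal_collapse[OF z(1)]] by blast
  have seg: "w \<in>\<^sub>M coll E {w. w \<in>\<^sub>M X \<and> R w z} \<longleftrightarrow> w \<in>\<^sub>M X \<and> R w z" for w
    using dfbl_separation[of "\<lambda>w. R w z" X] dfbl_R'[OF dtm_var dtm_const] by (simp add: mem_coll)
  have "emb a (coll E {w. w \<in>\<^sub>M X \<and> R w z})"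
  proof (rule embI_rel)
    show "dfbl (\<lambda>v. v 1 \<in>\<^sub>M X \<and> R (v 1) z \<and> v 0 = collapse (v 1))"
      by (intro dfb dfbl_R' dtm_app[OF dtm_collapse])
    show "\<exists>y. y \<in>\<^sub>M coll E {w. w \<in>\<^sub>M X \<and> R w z} \<and> y \<in>\<^sub>M X \<and> R y z \<and> x = collapse y" if "x \<in>\<^sub>M a" for x
      unfolding seg using sub[OF that] mem_collapse[OF z(1)] by blast
  qed (elim conjE, erule (1) collapse_inj, simp, simp)
  then show ?thesis using z(1) by blast
qed

end


section \<open>Products of infinite ordinals\<close>

context zf_model
begin

abbreviation pmax :: "'m \<Rightarrow> 'm" where
  "pmax z \<equiv> cup E (pfst z) (psnd z)"

text \<open>For ordinals \<open>pmax\<close> is the maximum of the components. Comparing maxima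
  first confines all predecessors of \<open>z\<close> to the square of
  \<open>succ E (pmax z)\<close>.\<close>

definition goedel_less :: "'m \<Rightarrow> 'm \<Rightarrow> bool" where
  "goedel_less z w \<longleftrightarrow> pmax z \<in>\<^sub>M pmax w \<or> pmax z = pmax w \<and>
     (pfst z \<in>\<^sub>M pfst w \<or> pfst z = pfst w \<and> psnd z \<in>\<^sub>M psnd w)"

lemma cup_ordinal:
  assumes "ordinal E a" "ordinal E b"
  shows "cup E a b = a \<and> (b = a \<or> b \<in>\<^sub>M a) \<or> cup E a b = b \<and> (a = b \<or> a \<in>\<^sub>M b)"
proof -
  have *: "cup E a b = a" if "b = a \<or> b \<in>\<^sub>M a" "ordinal E a" for a b
    by (rule extensionality) (use that ordinal_trans in auto)
  show ?thesis using ordinal_linear[OF assms] *[of b a] *[of a b] assms cup_commute by metis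
qed

lemma definable_wellorder_goedel:
  assumes a: "ordinal E a"
  shows "definable_wellorder E (cprod E a a) goedel_less"
proof
  have mem: "pfst z \<in>\<^sub>M a \<and> psnd z \<in>\<^sub>M a \<and> ordinal E (pfst z) \<and> ordinal E (psnd z) \<and> ordinal E (pmax z) \<and>
      z = opair E (pfst z) (psnd z)" if "z \<in>\<^sub>M cprod E a a" for z
    using that cup_ordinal ordinal_mem[OF a] by (auto simp: mem_cprod) metis
  show "dfbl (\<lambda>v. goedel_less (v 0) (v 1))" unfolding goedel_less_def by (intro dfb)
  show "goedel_less x z"
    if "x \<in>\<^sub>M cprod E a a" "y \<in>\<^sub>M cprod E a a" "z \<in>\<^sub>M cprod E a a" "goedel_less x y" "goedel_less y z"
    for x y z
  proof -
    have lex: "k \<in>\<^sub>M k'' \<or> k = k'' \<and> (a \<in>\<^sub>M a'' \<or> a = a'' \<and> b \<in>\<^sub>M b'')"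
      if "k \<in>\<^sub>M k' \<or> k = k' \<and> (a \<in>\<^sub>M a' \<or> a = a' \<and> b \<in>\<^sub>M b')"
        "k' \<in>\<^sub>M k'' \<or> k' = k'' \<and> (a' \<in>\<^sub>M a'' \<or> a' = a'' \<and> b' \<in>\<^sub>M b'')"
        "ordinal E k''" "ordinal E a''" "ordinal E b''" for k k' k'' a a' a'' b b' b''
      using that(1,2) ordinal_trans[OF that(3), of k' k] ordinal_trans[OF that(4), of a' a]
        ordinal_trans[OF that(5), of b' b] by (elim disjE conjE) simp_all
    show ?thesis using lex[OF that(4,5)[unfolded goedel_less_def]] mem[OF that(3)]
      unfolding goedel_less_def by simp
  qed
  show "\<not> goedel_less x x" for x unfolding goedel_less_def using mem_irrefl by blast
  show "x = y \<or> goedel_less x y \<or> goedel_less y x" if "x \<in>\<^sub>M cprod E a a" "y \<in>\<^sub>M cprod E a a" for x y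
  proof -
    have "x = y" if "pfst x = pfst y" "psnd x = psnd y" using mem[OF \<open>x \<in>\<^sub>M cprod E a a\<close>] mem[OF \<open>y \<in>\<^sub>M cprod E a a\<close>] that by metis
    then show ?thesis unfolding goedel_less_def using mem[OF that(1)] mem[OF that(2)] ordinal_linear by metis
  qed
  show "P z" if z: "z \<in>\<^sub>M cprod E a a" and d: "dfbl (\<lambda>v. P (v 0))"
    and ind: "\<And>z. z \<in>\<^sub>M cprod E a a \<Longrightarrow> (\<And>w. w \<in>\<^sub>M cprod E a a \<Longrightarrow> goedel_less w z \<Longrightarrow> P w) \<Longrightarrow> P z"
    for P z
  proof -
    \<comment> \<open>Three nested ordinal inductions, on the maximum, the first and the second
      component, match the three levels of the lexicographic order.\<close>
    have "\<forall>z. z \<in>\<^sub>M cprod E a a \<longrightarrow> pmax z = m \<longrightarrow> P z" if "ordinal E m" for m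
      using that
    proof (induction m rule: ordinal_induct)
      case definable
      show ?case by (intro dfb dfbl_app[OF d])
    next
      case (step m)
      note IHm = step.IH
      have "\<forall>z. z \<in>\<^sub>M cprod E a a \<longrightarrow> pmax z = m \<longrightarrow> pfst z = b \<longrightarrow> P z" if "ordinal E b" for b
        using that
      proof (induction b rule: ordinal_induct)
        case definable
        show ?case by (intro dfb dfbl_app[OF d])
      next
        case (step b)
        note IHb = step.IH
        have "\<forall>z. z \<in>\<^sub>M cprod E a a \<longrightarrow> pmax z = m \<longrightarrow> pfst z = b \<longrightarrow> psnd z = c \<longrightarrow> P z"
          if "ordinal E c" for c
          using that
        proof (induction c rule: ordinal_induct)
          case definable
          show ?case by (intro dfb dfbl_app[OF d])
        next
          case (step c)
          show ?case
          proof (intro allI impI)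
            fix z assume z: "z \<in>\<^sub>M cprod E a a" "pmax z = m" "pfst z = b" "psnd z = c"
            show "P z"
            proof (rule ind[OF z(1)])
              fix w assume w: "w \<in>\<^sub>M cprod E a a" "goedel_less w z"
              then have "pmax w \<in>\<^sub>M m \<or> pmax w = m \<and> (pfst w \<in>\<^sub>M b \<or> pfst w = b \<and> psnd w \<in>\<^sub>M c)"
                unfolding goedel_less_def z(2) unfolding z(3,4) by blast
              then consider "pmax w \<in>\<^sub>M m" | "pmax w = m" "pfst w \<in>\<^sub>M b" | "pmax w = m" "pfst w = b" "psnd w \<in>\<^sub>M c"
                by blast
              then show "P w" using IHm IHb step.IH w(1) by cases blast+
            qed
          qed
        qed
        then show ?case using mem by blast
      qed
      then show ?case using mem by blast
    qed
    then show "P z" using mem z by blast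
  qed
qed

text \<open>If \<open>a\<close> embeds into a smaller ordinal, the induction hypothesis for that
  ordinal is transported. Otherwise a failure would embed \<open>a\<close> into a proper segment of
  the square, hence into the square of some \<open>succ E m\<close> with \<open>m\<close> in
  \<open>a\<close>. This successor is infinite, as a product of natural numbers does not admit an
  embedding of \<omega>, so \<open>a\<close> would embed into a smaller ordinal after all.\<close>

theorem emb_ordinal_square:
  assumes "ordinal E a" "\<And>n. n \<in>\<^sub>M omega E \<Longrightarrow> n \<in>\<^sub>M a"
  shows "emb (cprod E a a) a"
proof -
  from assms(1) have "(\<forall>n. n \<in>\<^sub>M omega E \<longrightarrow> n \<in>\<^sub>M a) \<longrightarrow> emb (cprod E a a) a"
  proof (induction a rule: ordinal_induct)
    case definable
    show ?case by (intro dfb)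
  next
    case (step a)
    show ?case
    proof (intro impI)
      assume inf: "\<forall>n. n \<in>\<^sub>M omega E \<longrightarrow> n \<in>\<^sub>M a"
      then have emb_omega: "emb (omega E) a" by (intro emb_subset) blast
      have IH: "emb (cprod E b b) b" if "b \<in>\<^sub>M a" "\<not> b \<in>\<^sub>M omega E" for b
        using ordinal_finite_or_infinite[OF ordinal_mem[OF step.hyps that(1)]] step.IH[OF that(1)] that(2)
        by blast
      show "emb (cprod E a a) a"
      proof (cases "\<exists>b. b \<in>\<^sub>M a \<and> emb a b")
        case True
        then obtain b where b: "b \<in>\<^sub>M a" "emb a b" by blast
        then have "\<not> b \<in>\<^sub>M omega E" using emb_omega emb_trans emb_omega_nat by blast
        then have "emb (cprod E b b) b" using IH b by blast
        moreover have "emb b a" by (rule emb_subset) (rule ordinal_trans[OF step.hyps b(1)])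
        ultimately show ?thesis using emb_cprod[OF b(2) b(2)] emb_trans by blast
      next
        case False
        interpret definable_wellorder E "cprod E a a" goedel_less
          by (rule definable_wellorder_goedel[OF step.hyps])
        show ?thesis
        proof (rule ccontr)
          assume "\<not> emb (cprod E a a) a"
          then obtain z where z: "z \<in>\<^sub>M cprod E a a"
            and e: "emb a (coll E {w. w \<in>\<^sub>M cprod E a a \<and> goedel_less w z})"
            using emb_ordinal_or_segment[OF step.hyps] by blast
          define m where "m = pmax z"
          have m: "m \<in>\<^sub>M a"
            using z cup_ordinal ordinal_mem[OF step.hyps] unfolding m_def by (auto simp: mem_cprod) metis
          then have om: "ordinal E m" using ordinal_mem step.hyps by blast
          have seg: "w \<in>\<^sub>M coll E {w. w \<in>\<^sub>M cprod E a a \<and> goedel_less w z} \<longleftrightarrow> w \<in>\<^sub>M cprod E a a \<and> goedel_less w z" for w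
            using dfbl_separation[of "\<lambda>w. goedel_less w z"] dfbl_R'[OF dtm_var dtm_const] by (simp add: mem_coll)
          have "emb (coll E {w. w \<in>\<^sub>M cprod E a a \<and> goedel_less w z}) (cprod E (succ E m) (succ E m))"
          proof (rule emb_subset, unfold seg, elim conjE)
            fix w assume w: "w \<in>\<^sub>M cprod E a a" "goedel_less w z"
            then obtain x y where xy: "w = opair E x y" "x \<in>\<^sub>M a" "y \<in>\<^sub>M a" by (auto simp: mem_cprod)
            have "cup E x y = m \<or> cup E x y \<in>\<^sub>M m" using w(2) unfolding goedel_less_def m_def xy by auto
            moreover have "ordinal E x" "ordinal E y" using xy ordinal_mem[OF step.hyps] by auto
            ultimately have "(x = m \<or> x \<in>\<^sub>M m) \<and> (y = m \<or> y \<in>\<^sub>M m)"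
              using cup_ordinal[of x y] ordinal_trans[OF om] by metis
            then show "w \<in>\<^sub>M cprod E (succ E m) (succ E m)" using xy by simp
          qed
          then have e2: "emb a (cprod E (succ E m) (succ E m))" using e emb_trans by blast
          have nm: "\<not> succ E m \<in>\<^sub>M omega E"
            using e2 emb_omega emb_trans emb_omega_cprod by blast
          have "\<not> a \<in>\<^sub>M succ E m" using m mem_irrefl mem_asym by auto
          then consider "succ E m \<in>\<^sub>M a" | "succ E m = a"
            using ordinal_linear[OF step.hyps ordinal_succ[OF om]] by blast
          then show False
          proof cases
            case 1
            then have "emb a (succ E m)" using e2 IH[OF 1 nm] emb_trans by blast
            with 1 False show False by blast
          next
            case 2
            have "\<not> m \<in>\<^sub>M omega E" using nm succ_mem_omega by blast
            then have "emb (succ E m) m" using ordinal_finite_or_infinite[OF om] emb_succ[OF om] by blast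
            with 2 m False show False by blast
          qed
        qed
      qed
    qed
  qed
  with assms(2) show ?thesis by blast
qed

end

section \<open>Uniform realizability\<close>

locale realizability_model = zf_model E for E :: "'m \<Rightarrow> 'm \<Rightarrow> bool" (infix "\<in>\<^sub>M" 50) +
  fixes A :: "'m ralg"
  assumes algebra: "realizability_algebra E A"
begin

abbreviation app' (infixl "\<cdot>" 75) where "x \<cdot> y \<equiv> app E A x y"
abbreviation push' (infixr "\<bullet>" 70) where "x \<bullet> p \<equiv> push E A x p"
abbreviation in_pole (infix "\<star>" 60) where "x \<star> p \<equiv> opair E x p \<in>\<^sub>M Pole A"
abbreviation realizes' (infix "\<tturnstile>" 50) where "x \<tturnstile> F \<equiv> realizes E A x F"
abbreviation fv where "fv \<equiv> falsity E A"

section \<open>Typing and anti-execution rules of the algebra\<close>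

lemma app_Tm [simp]: "x \<in>\<^sub>M Tm A \<Longrightarrow> y \<in>\<^sub>M Tm A \<Longrightarrow> x \<cdot> y \<in>\<^sub>M Tm A"
  using algebra by (simp add: realizability_algebra_def is_map_def app_def)

lemma push_Stk [simp]: "x \<in>\<^sub>M Tm A \<Longrightarrow> p \<in>\<^sub>M Stk A \<Longrightarrow> x \<bullet> p \<in>\<^sub>M Stk A"
  using algebra by (simp add: realizability_algebra_def is_map_def push_def)

lemma kont_Tm [simp]: "p \<in>\<^sub>M Stk A \<Longrightarrow> kont E A p \<in>\<^sub>M Tm A"
  using algebra by (simp add: realizability_algebra_def is_map_def kont_def)

lemma QP_Tm: "x \<in>\<^sub>M QP A \<Longrightarrow> x \<in>\<^sub>M Tm A"
  using algebra unfolding realizability_algebra_def subset_iff mem_ext by blast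

lemma QP_app [simp]: "x \<in>\<^sub>M QP A \<Longrightarrow> y \<in>\<^sub>M QP A \<Longrightarrow> x \<cdot> y \<in>\<^sub>M QP A"
  using algebra unfolding realizability_algebra_def by blast

lemma instr_QP [simp]:
  "iB A \<in>\<^sub>M QP A" "iC A \<in>\<^sub>M QP A" "iI A \<in>\<^sub>M QP A" "iK A \<in>\<^sub>M QP A" "iW A \<in>\<^sub>M QP A" "icc A \<in>\<^sub>M QP A"
  using algebra by (simp_all add: realizability_algebra_def)

lemmas instr_Tm [simp] = instr_QP[THEN QP_Tm]

lemma pole_step:
  assumes "step E A (x, p) (x', p')" "x \<in>\<^sub>M Tm A" "p \<in>\<^sub>M Stk A" "x' \<star> p'"
  shows "x \<star> p"
proof -
  have "exec E A (x, p) (x', p')" unfolding exec_def using assms(1) by (rule r_into_rtranclp)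
  then show ?thesis using algebra assms(2-4) unfolding realizability_algebra_def by blast
qed

lemma pole_app: "x \<star> y \<bullet> p \<Longrightarrow> x \<in>\<^sub>M Tm A \<Longrightarrow> y \<in>\<^sub>M Tm A \<Longrightarrow> p \<in>\<^sub>M Stk A \<Longrightarrow> x \<cdot> y \<star> p"
  by (rule pole_step[OF step.intros(1)]) simp_all

lemma pole_I: "x \<star> p \<Longrightarrow> x \<in>\<^sub>M Tm A \<Longrightarrow> p \<in>\<^sub>M Stk A \<Longrightarrow> iI A \<star> x \<bullet> p"
  by (rule pole_step[OF step.intros(2)]) simp_all

lemma pole_K:
  "x \<star> p \<Longrightarrow> x \<in>\<^sub>M Tm A \<Longrightarrow> y \<in>\<^sub>M Tm A \<Longrightarrow> p \<in>\<^sub>M Stk A \<Longrightarrow> iK A \<star> x \<bullet> y \<bullet> p"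
  by (rule pole_step[OF step.intros(3)]) simp_all

lemma pole_W:
  "x \<star> y \<bullet> y \<bullet> p \<Longrightarrow> x \<in>\<^sub>M Tm A \<Longrightarrow> y \<in>\<^sub>M Tm A \<Longrightarrow> p \<in>\<^sub>M Stk A \<Longrightarrow> iW A \<star> x \<bullet> y \<bullet> p"
  by (rule pole_step[OF step.intros(4)]) simp_all

lemma pole_C:
  "x \<star> z \<bullet> y \<bullet> p \<Longrightarrow> x \<in>\<^sub>M Tm A \<Longrightarrow> y \<in>\<^sub>M Tm A \<Longrightarrow> z \<in>\<^sub>M Tm A \<Longrightarrow> p \<in>\<^sub>M Stk A \<Longrightarrow>
   iC A \<star> x \<bullet> y \<bullet> z \<bullet> p"
  by (rule pole_step[OF step.intros(5)]) simp_all

lemma pole_B: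
  "x \<star> (y \<cdot> z) \<bullet> p \<Longrightarrow> x \<in>\<^sub>M Tm A \<Longrightarrow> y \<in>\<^sub>M Tm A \<Longrightarrow> z \<in>\<^sub>M Tm A \<Longrightarrow> p \<in>\<^sub>M Stk A \<Longrightarrow>
   iB A \<star> x \<bullet> y \<bullet> z \<bullet> p"
  by (rule pole_step[OF step.intros(6)]) simp_all

lemma pole_cc: "x \<star> kont E A p \<bullet> p \<Longrightarrow> x \<in>\<^sub>M Tm A \<Longrightarrow> p \<in>\<^sub>M Stk A \<Longrightarrow> icc A \<star> x \<bullet> p"
  by (rule pole_step[OF step.intros(7)]) simp_all

lemma pole_kont:
  "x \<star> p \<Longrightarrow> x \<in>\<^sub>M Tm A \<Longrightarrow> p \<in>\<^sub>M Stk A \<Longrightarrow> q \<in>\<^sub>M Stk A \<Longrightarrow> kont E A p \<star> x \<bullet> q"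
  by (rule pole_step[OF step.intros(8)]) simp_all

lemmas pole_intros = pole_app pole_I pole_K pole_W pole_C pole_B

lemma realizes_Tm: "x \<tturnstile> F \<Longrightarrow> x \<in>\<^sub>M Tm A"
  by (simp add: realizes_def orth_def)

lemma realizesI: "x \<in>\<^sub>M Tm A \<Longrightarrow> (\<And>p. p \<in> fv F \<Longrightarrow> x \<star> p) \<Longrightarrow> x \<tturnstile> F"
  by (simp add: realizes_def orth_def)

lemma realizesD: "x \<tturnstile> F \<Longrightarrow> p \<in> fv F \<Longrightarrow> x \<star> p"
  by (simp add: realizes_def orth_def)

lemma fv_Stk: "p \<in> fv F \<Longrightarrow> p \<in>\<^sub>M Stk A"
  by (induction F arbitrary: p) (auto simp: section_at_def orth_def)

lemma fv_imp: "fv (F \<^bold>\<rightarrow> G) = {x \<bullet> p | x p. x \<tturnstile> F \<and> p \<in> fv G}"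
  by (simp add: realizes_def)

lemma realizes_antimono: "x \<tturnstile> F' \<Longrightarrow> fv F \<subseteq> fv F' \<Longrightarrow> x \<tturnstile> F"
  by (meson realizesD realizesI realizes_Tm subsetD)

lemma fv_imp_mono: "fv F \<subseteq> fv F' \<Longrightarrow> fv G \<subseteq> fv G' \<Longrightarrow> fv (F' \<^bold>\<rightarrow> G) \<subseteq> fv (F \<^bold>\<rightarrow> G')"
  unfolding fv_imp using realizes_antimono[of _ F' F] by blast

lemma fv_impI: "u \<tturnstile> F \<Longrightarrow> p \<in> fv G \<Longrightarrow> u \<bullet> p \<in> fv (F \<^bold>\<rightarrow> G)"
  unfolding fv_imp by blast

lemma realizes_impI:
  "t \<in>\<^sub>M Tm A \<Longrightarrow> (\<And>u p. u \<tturnstile> F \<Longrightarrow> u \<in>\<^sub>M Tm A \<Longrightarrow> p \<in> fv G \<Longrightarrow> p \<in>\<^sub>M Stk A \<Longrightarrow> t \<star> u \<bullet> p) \<Longrightarrow>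
   t \<tturnstile> F \<^bold>\<rightarrow> G"
  by (rule realizesI) (use fv_Stk realizes_Tm in \<open>auto simp: fv_imp simp del: falsity.simps\<close>)

lemma realizes_app: "t \<tturnstile> F \<^bold>\<rightarrow> G \<Longrightarrow> u \<tturnstile> F \<Longrightarrow> t \<cdot> u \<tturnstile> G"
proof (rule realizesI)
  fix p assume *: "t \<tturnstile> F \<^bold>\<rightarrow> G" "u \<tturnstile> F" "p \<in> fv G"
  then have "t \<star> u \<bullet> p" by (intro realizesD[OF *(1)] fv_impI)
  then show "t \<cdot> u \<star> p" using * realizes_Tm fv_Stk by (intro pole_app) auto
qed (use realizes_Tm in auto)

text \<open>The head of the list becomes the innermost premise, so discharging the most recent
  hypothesis is a mere rewriting.\<close>

primrec imps :: "'m form list \<Rightarrow> 'm form \<Rightarrow> 'm form" where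
  "imps [] F = F"
| "imps (H # G) F = imps G (H \<^bold>\<rightarrow> F)"

lemma imps_mono: "fv F \<subseteq> fv F' \<Longrightarrow> fv (imps G F) \<subseteq> fv (imps G F')"
  by (induction G arbitrary: F F') (simp_all add: fv_imp_mono del: falsity.simps)

text \<open>The falsity value of an implication distributes over unions in its conclusion. A
  quantifier can thus be moved across a context without changing the realizing term.\<close>

lemma imps_Univ: "fv (imps G (Univ F)) = (\<Union>a. fv (imps G (F a)))"
proof (induction G arbitrary: F)
  case (Cons H G)
  have "fv (H \<^bold>\<rightarrow> Univ F) = fv (Univ (\<lambda>a. H \<^bold>\<rightarrow> F a))" by auto
  then have "fv (imps G (H \<^bold>\<rightarrow> Univ F)) = fv (imps G (Univ (\<lambda>a. H \<^bold>\<rightarrow> F a)))"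
    by (intro subset_antisym imps_mono) simp_all
  with Cons show ?case by simp
qed simp

lemma imps_empty: "fv F = {} \<Longrightarrow> fv (imps G F) = {}"
  by (induction G arbitrary: F) auto

text \<open>
  The same proof-like term has to serve all indices: this is what the realizability of a universal
  formula asks for.  Hypotheses that are decided in the ground model are used by restricting the
  index set.  The most recent hypothesis comes first in a context.
\<close>

definition der :: "'i set \<Rightarrow> ('i \<Rightarrow> 'm form) list \<Rightarrow> ('i \<Rightarrow> 'm form) \<Rightarrow> bool" where
  "der I G F \<longleftrightarrow> (\<exists>t. t \<in>\<^sub>M QP A \<and> (\<forall>i\<in>I. t \<tturnstile> imps (map (\<lambda>H. H i) G) (F i)))"

lemma realized_if_der: "der I [] (\<lambda>_. F) \<Longrightarrow> i \<in> I \<Longrightarrow> realized E A F"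
  by (auto simp: der_def realized_def)

lemma der_Cons: "der I (H # G) F = der I G (\<lambda>i. H i \<^bold>\<rightarrow> F i)"
  by (simp add: der_def)

lemmas der_impI = der_Cons[THEN iffD1]

section \<open>Hilbert-style axioms of classical implication and their use in contexts\<close>

lemma der_app_Nil: "der I [] (\<lambda>i. F i \<^bold>\<rightarrow> H i) \<Longrightarrow> der I [] F \<Longrightarrow> der I [] H"
  unfolding der_def list.map imps.simps using realizes_app QP_app by meson

lemma der_I: "der I [] (\<lambda>i. F i \<^bold>\<rightarrow> F i)"
proof -
  have "iI A \<tturnstile> F \<^bold>\<rightarrow> F" for F
    by (rule realizes_impI) (auto intro!: pole_intros intro: realizesD)
  then show ?thesis unfolding der_def by (intro exI[of _ "iI A"]) simp
qed

lemma der_K: "der I [] (\<lambda>i. F i \<^bold>\<rightarrow> H i \<^bold>\<rightarrow> F i)"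
proof -
  have "iK A \<tturnstile> F \<^bold>\<rightarrow> H \<^bold>\<rightarrow> F" for F H
    by (rule realizesI) (auto simp: fv_imp simp del: falsity.simps
        intro!: pole_intros intro: realizesD realizes_Tm fv_Stk)
  then show ?thesis unfolding der_def by (intro exI[of _ "iK A"]) simp
qed

lemma der_S: "der I [] (\<lambda>i. (F i \<^bold>\<rightarrow> H i \<^bold>\<rightarrow> J i) \<^bold>\<rightarrow> (F i \<^bold>\<rightarrow> H i) \<^bold>\<rightarrow> F i \<^bold>\<rightarrow> J i)"
proof -
  let ?B = "iB A" and ?C = "iC A" and ?W = "iW A"
  \<comment> \<open>The standard translation of the combinator S: applied to t, u, x it executes to
    t with arguments x and (u)x.\<close>
  let ?S = "?B \<cdot> (?B \<cdot> ?W) \<cdot> (?B \<cdot> ?C \<cdot> (?B \<cdot> ?B))"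
  have "?S \<tturnstile> (F \<^bold>\<rightarrow> H \<^bold>\<rightarrow> J) \<^bold>\<rightarrow> (F \<^bold>\<rightarrow> H) \<^bold>\<rightarrow> F \<^bold>\<rightarrow> J" for F H J
  proof (rule realizesI)
    fix q assume "q \<in> fv ((F \<^bold>\<rightarrow> H \<^bold>\<rightarrow> J) \<^bold>\<rightarrow> (F \<^bold>\<rightarrow> H) \<^bold>\<rightarrow> F \<^bold>\<rightarrow> J)"
    then obtain t u x p where q: "q = t \<bullet> u \<bullet> x \<bullet> p" and
      r: "t \<tturnstile> F \<^bold>\<rightarrow> H \<^bold>\<rightarrow> J" "u \<tturnstile> F \<^bold>\<rightarrow> H" "x \<tturnstile> F" "p \<in> fv J"
      unfolding fv_imp mem_Collect_eq by blast
    have "t \<star> x \<bullet> (u \<cdot> x) \<bullet> p"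
      by (intro realizesD[OF r(1)] fv_impI r realizes_app[OF r(2)])
    moreover have "t \<in>\<^sub>M Tm A" "u \<in>\<^sub>M Tm A" "x \<in>\<^sub>M Tm A" "p \<in>\<^sub>M Stk A" using r realizes_Tm fv_Stk by auto
    ultimately show "?S \<star> q" unfolding q by (intro pole_intros) simp_all
  qed simp
  then show ?thesis unfolding der_def by (intro exI[of _ ?S]) simp
qed

text \<open>For a stack \<open>p\<close> in the falsity value of \<open>F\<close>, the continuation
  of \<open>p\<close> realizes an implication from \<open>F\<close> to anything: it discards the
  current stack and restores \<open>p\<close>.\<close>

lemma der_peirce: "der I [] (\<lambda>i. ((F i \<^bold>\<rightarrow> H i) \<^bold>\<rightarrow> F i) \<^bold>\<rightarrow> F i)"
proof -
  have "icc A \<tturnstile> ((F \<^bold>\<rightarrow> H) \<^bold>\<rightarrow> F) \<^bold>\<rightarrow> F" for F H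
  proof (rule realizes_impI)
    fix t p assume t: "t \<tturnstile> (F \<^bold>\<rightarrow> H) \<^bold>\<rightarrow> F" "t \<in>\<^sub>M Tm A" "p \<in> fv F" "p \<in>\<^sub>M Stk A"
    have "kont E A p \<tturnstile> F \<^bold>\<rightarrow> H"
      by (rule realizes_impI) (use t in \<open>auto intro: pole_kont realizesD\<close>)
    then have "t \<star> kont E A p \<bullet> p"
      by (intro realizesD[OF t(1)] fv_impI t)
    then show "icc A \<star> t \<bullet> p" using t by (intro pole_cc)
  qed simp
  then show ?thesis unfolding der_def by (intro exI[of _ "icc A"]) simp
qed

lemma der_imps_if_Nil: "der I [] F \<Longrightarrow> der I G F"
proof (induction G arbitrary: F)
  case (Cons H G)
  show ?case unfolding der_Cons by (rule Cons.IH) (rule der_app_Nil[OF der_K Cons.prems])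
qed

text \<open>The step of the deduction theorem: each hypothesis of the context is distributed over
  the application by the combinator S.\<close>

lemma der_mp: "der I G (\<lambda>i. F i \<^bold>\<rightarrow> H i) \<Longrightarrow> der I G F \<Longrightarrow> der I G H"
proof (induction G arbitrary: F H)
  case Nil
  then show ?case by (rule der_app_Nil)
next
  case (Cons J G)
  show ?case using Cons.prems unfolding der_Cons
    by (rule Cons.IH[OF Cons.IH[OF der_imps_if_Nil[OF der_S]]])
qed

lemma der_hyp: "F \<in> set G \<Longrightarrow> der I G F"
proof (induction G)
  case (Cons H G)
  show ?case
  proof (cases "F = H")
    case True
    then show ?thesis unfolding der_Cons using der_imps_if_Nil[OF der_I] by blast
  next
    case False
    then have "der I G F" using Cons by simp
    then show ?thesis unfolding der_Cons by (rule der_mp[OF der_imps_if_Nil[OF der_K]])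
  qed
qed simp

lemma der_weaken: "der I G F \<Longrightarrow> set G \<subseteq> set G' \<Longrightarrow> der I G' F"
proof (induction G arbitrary: F)
  case Nil
  then show ?case using der_imps_if_Nil by blast
next
  case (Cons H G)
  then have "der I G' (\<lambda>i. H i \<^bold>\<rightarrow> F i)" unfolding der_Cons by simp
  then show ?case using Cons.prems by (auto intro: der_mp der_hyp)
qed

lemma der_subset: "der I G F \<Longrightarrow> J \<subseteq> I \<Longrightarrow> der J G F"
  unfolding der_def by blast

lemma der_mono: "der I G F \<Longrightarrow> (\<And>i. i \<in> I \<Longrightarrow> fv (F' i) \<subseteq> fv (F i)) \<Longrightarrow> der I G F'"
  unfolding der_def using imps_mono by (meson realizesD realizesI realizes_Tm subsetD)

text \<open>Where \<open>b\<close> fails, the whole implication has an empty falsity value and every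
  term realizes it; so the term found for the restricted index set already works for all of
  \<open>I\<close>.\<close>

lemma der_restrict:
  assumes "der {i \<in> I. b i} G F" and "\<And>i. i \<in> I \<Longrightarrow> \<not> b i \<Longrightarrow> fv (F i) = {}"
  shows "der I G F"
proof -
  obtain t where t: "t \<in>\<^sub>M QP A" "\<And>i. i \<in> I \<Longrightarrow> b i \<Longrightarrow> t \<tturnstile> imps (map (\<lambda>H. H i) G) (F i)"
    using assms(1) unfolding der_def by blast
  have "t \<tturnstile> imps (map (\<lambda>H. H i) G) (F i)" if "i \<in> I" for i
    using t imps_empty[OF assms(2)[OF that]] that by (cases "b i") (auto intro!: realizesI QP_Tm)
  with t(1) show ?thesis unfolding der_def by blast
qed

text \<open>The bound individual becomes a further index component, which is how uniformity of the
  term in it is expressed.\<close>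

lemma der_allI:
  assumes "der (I \<times> UNIV) (map (\<lambda>H p. H (fst p)) G) (\<lambda>p. F (fst p) (snd p))"
  shows "der I G (\<lambda>i. Univ (F i))"
proof -
  obtain t where t: "t \<in>\<^sub>M QP A" "\<And>i a. i \<in> I \<Longrightarrow> t \<tturnstile> imps (map (\<lambda>H. H i) G) (F i a)"
    using assms unfolding der_def by (auto simp: comp_def)
  then have "\<forall>i\<in>I. t \<tturnstile> imps (map (\<lambda>H. H i) G) (Univ (F i))"
    by (auto intro!: realizesI QP_Tm simp: imps_Univ) (metis realizesD)
  with t(1) show ?thesis unfolding der_def by blast
qed

lemma der_allE: "der I G (\<lambda>i. Univ (F i)) \<Longrightarrow> der I G (\<lambda>i. F i (a i))"
  by (rule der_mono) auto

section \<open>Classical rules for negation, the connectives and existence\<close>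

lemma der_botE: "der I G (\<lambda>i. Bot) \<Longrightarrow> der I G F"
  by (rule der_mono) (auto intro: fv_Stk)

lemma der_ccontr: "der I ((\<lambda>i. Negation (F i)) # G) (\<lambda>i. Bot) \<Longrightarrow> der I G F"
  using der_mp[OF der_imps_if_Nil[OF der_peirce] der_impI[OF der_botE]] unfolding Negation_def .

lemma der_weaken1: "der I G F \<Longrightarrow> der I (H # G) F"
  by (erule der_weaken) auto

lemma der_hyp1: "der I (H # G) H"
  by (rule der_hyp) simp

lemma der_andI:
  assumes "der I G F" "der I G H"
  shows "der I G (\<lambda>i. F i \<^bold>\<and> H i)"
  unfolding And_def
  by (rule der_impI, rule der_mp[OF der_mp[OF der_hyp1]]) (intro der_weaken1 assms)+

lemma der_andE1: "der I G (\<lambda>i. F i \<^bold>\<and> H i) \<Longrightarrow> der I G F"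
proof (rule der_ccontr)
  assume a: "der I G (\<lambda>i. F i \<^bold>\<and> H i)"
  show "der I ((\<lambda>i. Negation (F i)) # G) (\<lambda>i. Bot)"
  proof (rule der_mp[OF der_weaken1[OF a[unfolded And_def]]], intro der_impI)
    show "der I (H # F # (\<lambda>i. Negation (F i)) # G) (\<lambda>i. Bot)"
      by (rule der_mp[where F = F]; rule der_hyp; simp add: Negation_def)
  qed
qed

lemma der_andE2: "der I G (\<lambda>i. F i \<^bold>\<and> H i) \<Longrightarrow> der I G H"
proof (rule der_ccontr)
  assume a: "der I G (\<lambda>i. F i \<^bold>\<and> H i)"
  show "der I ((\<lambda>i. Negation (H i)) # G) (\<lambda>i. Bot)"
  proof (rule der_mp[OF der_weaken1[OF a[unfolded And_def]]], intro der_impI)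
    show "der I (H # F # (\<lambda>i. Negation (H i)) # G) (\<lambda>i. Bot)"
      by (rule der_mp[where F = H]; rule der_hyp; simp add: Negation_def)
  qed
qed

lemma der_orI1:
  assumes "der I G F"
  shows "der I G (\<lambda>i. F i \<^bold>\<or> H i)"
  unfolding Or_def
proof (intro der_impI)
  show "der I ((\<lambda>i. Negation (H i)) # (\<lambda>i. Negation (F i)) # G) (\<lambda>i. Bot)"
    by (rule der_mp[where F = F], rule der_hyp, simp add: Negation_def) (intro der_weaken1 assms)
qed

lemma der_orI2:
  assumes "der I G H"
  shows "der I G (\<lambda>i. F i \<^bold>\<or> H i)"
  unfolding Or_def
proof (intro der_impI)
  show "der I ((\<lambda>i. Negation (H i)) # (\<lambda>i. Negation (F i)) # G) (\<lambda>i. Bot)"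
    by (rule der_mp[where F = H], rule der_hyp, simp add: Negation_def) (intro der_weaken1 assms)
qed

lemma der_notI_by_contra:
  assumes "der I (F # G) C"
  shows "der I ((\<lambda>i. Negation (C i)) # G) (\<lambda>i. Negation (F i))"
  unfolding Negation_def
  by (rule der_impI, rule der_mp[where F = C], rule der_hyp, simp, rule der_weaken[OF assms]) auto

lemma der_orE:
  assumes "der I G (\<lambda>i. F i \<^bold>\<or> H i)" "der I (F # G) C" "der I (H # G) C"
  shows "der I G C"
  by (rule der_ccontr, rule der_mp[OF der_mp[OF der_weaken1[OF assms(1)[unfolded Or_def]]]])
    (rule der_notI_by_contra assms)+

lemma der_iffI:
  "der I (F # G) H \<Longrightarrow> der I (H # G) F \<Longrightarrow> der I G (\<lambda>i. F i \<^bold>\<leftrightarrow> H i)"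
  unfolding Iff_def by (intro der_andI der_impI)

lemma der_iffD1: "der I G (\<lambda>i. F i \<^bold>\<leftrightarrow> H i) \<Longrightarrow> der I G F \<Longrightarrow> der I G H"
  unfolding Iff_def by (rule der_mp[OF der_andE1])

lemma der_iffD2: "der I G (\<lambda>i. F i \<^bold>\<leftrightarrow> H i) \<Longrightarrow> der I G H \<Longrightarrow> der I G F"
  unfolding Iff_def by (rule der_mp[OF der_andE2])

text \<open>The witness may be an arbitrary HOL function of the index: realizers do not carry
  individuals, so it need be neither definable nor uniform.\<close>

lemma der_exI:
  assumes "der I G (\<lambda>i. F i (a i))"
  shows "der I G (\<lambda>i. Exist (F i))"
  unfolding Exist_def Negation_def
  by (rule der_impI, rule der_mp[OF der_allE[OF der_hyp1]], rule der_weaken1[OF assms])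

lemma der_exE:
  assumes "der I G (\<lambda>i. Exist (F i))"
    and "der (I \<times> UNIV) ((\<lambda>p. F (fst p) (snd p)) # map (\<lambda>H p. H (fst p)) G) (\<lambda>p. C (fst p))"
  shows "der I G C"
proof (rule der_ccontr, rule der_mp[OF der_weaken1[OF assms(1)[unfolded Exist_def Negation_def]]],
    rule der_allI)
  show "der (I \<times> UNIV) (map (\<lambda>H p. H (fst p)) ((\<lambda>i. Negation (C i)) # G))
      (\<lambda>p. F (fst p) (snd p) \<^bold>\<rightarrow> Bot)"
    using der_notI_by_contra[OF assms(2)] by (simp add: Negation_def)
qed


section \<open>Rules for \<open>gimel\<close>, Leibniz equality and pairs\<close>

lemma mem_gimel: "opair E x p \<in>\<^sub>M gimel E A X \<longleftrightarrow> x \<in>\<^sub>M X \<and> p \<in>\<^sub>M Stk A"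
  by (simp add: gimel_def)

text \<open>For an element of \<open>X\<close> every stack refutes non-membership, so the membership
  formula has the falsity value of \<open>Bot\<close> implies \<open>Bot\<close>, and the identity
  realizes it.\<close>

lemma der_gimelI: "(\<And>i. i \<in> I \<Longrightarrow> z i \<in>\<^sub>M X i) \<Longrightarrow> der I G (\<lambda>i. z i \<^bold>\<in> gimel E A (X i))"
  by (rule der_mono[OF der_imps_if_Nil[OF der_I[of _ "\<lambda>_. Bot"]]])
    (auto simp: Eps_def Negation_def mem_gimel orth_def ext_def)

text \<open>
  Where \<open>b\<close> fails, \<open>if b then Bot else Top\<close> has an empty falsity value.  The negation of \<open>F\<close>,
  composed with a derivation of \<open>F\<close> from \<open>b\<close>, therefore realizes it for all indices.
\<close>

lemma der_decideE:
  assumes "der I G (\<lambda>i. (if b i then Bot else Top) \<^bold>\<rightarrow> (if c i then Bot else Top) \<^bold>\<rightarrow> Bot)"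
    and "\<And>J. J \<subseteq> I \<Longrightarrow> (\<And>i. i \<in> J \<Longrightarrow> b i) \<Longrightarrow> der J G F"
    and "\<And>J. J \<subseteq> I \<Longrightarrow> (\<And>i. i \<in> J \<Longrightarrow> c i) \<Longrightarrow> der J G F"
  shows "der I G F"
proof -
  have *: "der I ((\<lambda>i. Negation (F i)) # G) (\<lambda>i. if b i then Bot else Top)"
    if "\<And>J. J \<subseteq> I \<Longrightarrow> (\<And>i. i \<in> J \<Longrightarrow> b i) \<Longrightarrow> der J G F" for b
  proof (rule der_restrict)
    have "der {i \<in> I. b i} ((\<lambda>i. Negation (F i)) # G) (\<lambda>i. Bot)"
      by (rule der_mp[where F = F], unfold Negation_def, rule der_hyp1, rule der_weaken1, rule that) auto
    then show "der {i \<in> I. b i} ((\<lambda>i. Negation (F i)) # G) (\<lambda>i. if b i then Bot else Top)"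
      by (rule der_mono) auto
  qed auto
  show ?thesis
    by (rule der_ccontr, rule der_mp[OF der_mp[OF der_weaken1[OF assms(1)]]])
      (rule *, rule assms(2,3), assumption, assumption)+
qed

lemma der_crispE:
  assumes "der I G (\<lambda>i. (if b i then Bot else Top) \<^bold>\<rightarrow> Bot)"
    and "\<And>J. J \<subseteq> I \<Longrightarrow> (\<And>i. i \<in> J \<Longrightarrow> b i) \<Longrightarrow> der J G F"
  shows "der I G F"
proof (rule der_decideE[where b = b and c = b])
  show "der I G (\<lambda>i. (if b i then Bot else Top) \<^bold>\<rightarrow> (if b i then Bot else Top) \<^bold>\<rightarrow> Bot)"
    by (rule der_impI, rule der_weaken1, rule assms(1))
qed (rule assms(2); assumption)+

lemma der_crispI: "(\<And>i. i \<in> I \<Longrightarrow> b i) \<Longrightarrow> der I G (\<lambda>i. (if b i then Bot else Top) \<^bold>\<rightarrow> Bot)"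
  by (rule der_mono[OF der_imps_if_Nil[OF der_I[of _ "\<lambda>_. Bot"]]]) simp

text \<open>Outside \<open>X\<close> no stack refutes non-membership in \<open>gimel E A X\<close>,
  inside \<open>X\<close> every stack does; so a derived membership allows restriction to the
  indices where it holds in the ground model.\<close>

lemma der_gimelE:
  assumes "der I G (\<lambda>i. z i \<^bold>\<in> gimel E A (X i))"
    and "\<And>J. J \<subseteq> I \<Longrightarrow> (\<And>i. i \<in> J \<Longrightarrow> z i \<in>\<^sub>M X i) \<Longrightarrow> der J G F"
  shows "der I G F"
proof (rule der_crispE[OF der_mono[OF assms(1)] assms(2)])
  show "fv ((if z i \<in>\<^sub>M X i then Bot else Top) \<^bold>\<rightarrow> Bot) \<subseteq> fv (z i \<^bold>\<in> gimel E A (X i))" for i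
    unfolding Eps_def Negation_def by (rule fv_imp_mono) (auto simp: mem_gimel)
qed

lemma der_eqI:
  assumes "\<And>i. i \<in> I \<Longrightarrow> x i = y i"
  shows "der I G (\<lambda>i. x i \<^bold>= y i)"
  unfolding Eq_def
proof (rule der_allI, rule der_mono[OF der_imps_if_Nil[OF der_I[of _ "\<lambda>p. NotEps (x (fst p)) (snd p)"]]])
  fix p assume "p \<in> I \<times> (UNIV :: 'm set)"
  then have "x (fst p) = y (fst p)" using assms by auto
  then show "fv (NotEps (y (fst p)) (snd p) \<^bold>\<rightarrow> NotEps (x (fst p)) (snd p)) \<subseteq>
      fv (NotEps (x (fst p)) (snd p) \<^bold>\<rightarrow> NotEps (x (fst p)) (snd p))" by simp
qed

lemma mem_gimel_singleton: "opair E x p \<in>\<^sub>M gimel E A (coll E {y}) \<longleftrightarrow> x = y \<and> p \<in>\<^sub>M Stk A"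
  by (simp add: mem_gimel mem_singleton)

lemma der_eqE:
  assumes "der I G (\<lambda>i. x i \<^bold>= y i)"
    and "\<And>J. J \<subseteq> I \<Longrightarrow> (\<And>i. i \<in> J \<Longrightarrow> x i = y i) \<Longrightarrow> der J G F"
  shows "der I G F"
proof (rule der_crispE[OF der_mono[OF der_allE[OF assms(1)[unfolded Eq_def]]] assms(2)])
  fix i assume "i \<in> I"
  \<comment> \<open>Instantiating Leibniz equality with this singleton makes its conclusion behave
    as \<open>Bot\<close> and its premise as \<open>Bot\<close> or \<open>Top\<close>, according to
    actual equality.\<close>
  let ?s = "gimel E A (coll E {x i})"
  show "fv ((if x i = y i then Bot else Top) \<^bold>\<rightarrow> Bot) \<subseteq> fv (NotEps (y i) ?s \<^bold>\<rightarrow> NotEps (x i) ?s)"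
    by (rule fv_imp_mono) (auto simp: mem_gimel_singleton)
qed

text \<open>
  The \<open>\<epsilon>\<close>-members of \<open>gimel {a, b}\<close> may include more than \<open>a\<close> and \<open>b\<close>, because the choice between
  the two need not be made by a proof-like term.  In the unordered pair used here the
  stacks start with a term that makes this choice.
\<close>

definition upair :: "'m \<Rightarrow> 'm \<Rightarrow> 'm" where
  "upair a b = coll E {z. \<exists>p q. p \<in>\<^sub>M Stk A \<and>
     (opair E (opair E (iK A) p) q \<in>\<^sub>M Push A \<and> z = opair E a q \<or>
      opair E (opair E (iK A \<cdot> iI A) p) q \<in>\<^sub>M Push A \<and> z = opair E b q)}"

text \<open>This is why \<open>upair\<close> refers to the graph \<open>Push A\<close>, a parameter,
  instead of to \<open>push\<close>: the closure rules then apply to its body.\<close>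

lemma dtm_upair [dfb]: "dtm t \<Longrightarrow> dtm s \<Longrightarrow> dtm (\<lambda>v. upair (t v) (s v))"
  by (rule dtm_app2[of upair]) (unfold upair_def, intro dfb)

lemma opair_mem_Push:
  assumes "x \<in>\<^sub>M Tm A" "p \<in>\<^sub>M Stk A"
  shows "opair E (opair E x p) q \<in>\<^sub>M Push A \<longleftrightarrow> q = x \<bullet> p"
proof -
  have "is_fun E (Push A) (cprod E (Tm A) (Stk A))"
    using algebra by (simp add: realizability_algebra_def is_map_def)
  then have "\<exists>!q. opair E (opair E x p) q \<in>\<^sub>M Push A"
    using assms unfolding is_fun_def by simp
  then show ?thesis unfolding push_def ap_def by (metis theI')
qed

lemma mem_upair: "opair E z q \<in>\<^sub>M upair a b \<longleftrightarrow>
    (\<exists>p. p \<in>\<^sub>M Stk A \<and> (z = a \<and> q = iK A \<bullet> p \<or> z = b \<and> q = (iK A \<cdot> iI A) \<bullet> p))"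
proof -
  have "is_set E {z. \<exists>p q. p \<in>\<^sub>M Stk A \<and>
     (opair E (opair E (iK A) p) q \<in>\<^sub>M Push A \<and> z = opair E a q \<or>
      opair E (opair E (iK A \<cdot> iI A) p) q \<in>\<^sub>M Push A \<and> z = opair E b q)}"
    by (rule is_set_subclass[where a = "cprod E (coll E {a, b}) (Stk A)"], intro dfb)
      (auto simp: mem_pair opair_mem_Push)
  then show ?thesis by (simp add: upair_def mem_coll opair_mem_Push cong: conj_cong) blast
qed

lemma fv_upair: "fv (NotEps z (upair a b)) =
    {q. \<exists>p. p \<in>\<^sub>M Stk A \<and> (z = a \<and> q = iK A \<bullet> p \<or> z = b \<and> q = (iK A \<cdot> iI A) \<bullet> p)}"
  by (auto simp: mem_upair)

text \<open>The realizer hands the selector to its argument: C I k, met by u on a stack p, runs u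
  with k on top of p. The selector is K for the first component and K I for the second.\<close>

lemma der_upairI:
  assumes "\<And>i. i \<in> I \<Longrightarrow> s i = upair (a i) (b i)"
  shows "der I G (\<lambda>i. a i \<^bold>\<in> s i)" "der I G (\<lambda>i. b i \<^bold>\<in> s i)"
proof -
  have *: "iC A \<cdot> iI A \<cdot> k \<tturnstile> z \<^bold>\<in> upair a b"
    if k: "k \<in>\<^sub>M Tm A" "\<And>p. p \<in>\<^sub>M Stk A \<Longrightarrow> k \<bullet> p \<in> fv (NotEps z (upair a b))" for k z a b
    unfolding Eps_def Negation_def
  proof (rule realizes_impI)
    fix u p assume u: "u \<tturnstile> NotEps z (upair a b)" "u \<in>\<^sub>M Tm A" "p \<in>\<^sub>M Stk A"
    then have "u \<star> k \<bullet> p" using k realizesD by blast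
    then show "iC A \<cdot> iI A \<cdot> k \<star> u \<bullet> p" using u k by (intro pole_intros) simp_all
  qed (use k in simp)
  have "iC A \<cdot> iI A \<cdot> iK A \<tturnstile> a i \<^bold>\<in> s i" "iC A \<cdot> iI A \<cdot> (iK A \<cdot> iI A) \<tturnstile> b i \<^bold>\<in> s i"
    if "i \<in> I" for i
    unfolding assms[OF that] by (rule *, simp, unfold fv_upair, blast)+
  moreover have "iC A \<cdot> iI A \<cdot> iK A \<in>\<^sub>M QP A" "iC A \<cdot> iI A \<cdot> (iK A \<cdot> iI A) \<in>\<^sub>M QP A" by simp_all
  ultimately have "der I [] (\<lambda>i. a i \<^bold>\<in> s i)" "der I [] (\<lambda>i. b i \<^bold>\<in> s i)"
    unfolding der_def list.map imps.simps by blast+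
  then show "der I G (\<lambda>i. a i \<^bold>\<in> s i)" "der I G (\<lambda>i. b i \<^bold>\<in> s i)" using der_imps_if_Nil by blast+
qed

lemma der_upairE:
  assumes "der I G (\<lambda>i. z i \<^bold>\<in> s i)" and "\<And>i. i \<in> I \<Longrightarrow> s i = upair (a i) (b i)"
    and "\<And>J. J \<subseteq> I \<Longrightarrow> (\<And>i. i \<in> J \<Longrightarrow> z i = a i) \<Longrightarrow> der J G F"
    and "\<And>J. J \<subseteq> I \<Longrightarrow> (\<And>i. i \<in> J \<Longrightarrow> z i = b i) \<Longrightarrow> der J G F"
  shows "der I G F"
proof (rule der_decideE[OF _ assms(3,4)])
  \<comment> \<open>On x, y, k and p this term executes k against x, y and p. The selector k found
    on the stack thus picks x or y, whichever belongs to the component that \<open>z\<close>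
    equals.\<close>
  let ?T = "iB A \<cdot> iC A \<cdot> (iC A \<cdot> iI A)"
  let ?X = "\<lambda>b :: bool. if b then Bot else Top"
  have "?T \<tturnstile> ?X (z = a) \<^bold>\<rightarrow> ?X (z = b) \<^bold>\<rightarrow> NotEps z (upair a b)" for z a b
  proof (rule realizesI)
    fix q assume "q \<in> fv (?X (z = a) \<^bold>\<rightarrow> ?X (z = b) \<^bold>\<rightarrow> NotEps z (upair a b))"
    then obtain x y r where q: "q = x \<bullet> y \<bullet> r" and x: "x \<tturnstile> ?X (z = a)" and y: "y \<tturnstile> ?X (z = b)"
      and "r \<in> fv (NotEps z (upair a b))"
      unfolding fv_imp mem_Collect_eq by blast
    then obtain p where p: "p \<in>\<^sub>M Stk A" and r: "z = a \<and> r = iK A \<bullet> p \<or> z = b \<and> r = (iK A \<cdot> iI A) \<bullet> p"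
      unfolding fv_upair by blast
    have tm: "x \<in>\<^sub>M Tm A" "y \<in>\<^sub>M Tm A" using x y realizes_Tm by auto
    have "x \<star> p" if "z = a" using x that p by (intro realizesD[OF x]) simp
    moreover have "y \<star> p" if "z = b" using y that p by (intro realizesD[OF y]) simp
    ultimately show "?T \<star> q" unfolding q using r tm p by (auto intro!: pole_intros)
  qed simp
  then have "der I [] (\<lambda>i. ?X (z i = a i) \<^bold>\<rightarrow> ?X (z i = b i) \<^bold>\<rightarrow> NotEps (z i) (s i))"
    unfolding der_def using assms(2) by (intro exI[of _ ?T]) simp
  then have *: "der I [\<lambda>i. ?X (z i = b i), \<lambda>i. ?X (z i = a i)] (\<lambda>i. NotEps (z i) (s i))"
    by (simp add: der_Cons)
  show "der I G (\<lambda>i. ?X (z i = a i) \<^bold>\<rightarrow> ?X (z i = b i) \<^bold>\<rightarrow> Bot)"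
    by (intro der_impI, rule der_mp[OF der_weaken1[OF der_weaken1[OF assms(1)[unfolded Eps_def Negation_def]]]])
      (rule der_weaken[OF *], auto)
qed

lemma der_Is_upairI:
  assumes "\<And>i. i \<in> I \<Longrightarrow> s i = upair (a i) (b i)"
  shows "der I G (\<lambda>i. Is_upair (s i) (a i) (b i))"
  unfolding Is_upair_def
proof (intro der_allI der_iffI)
  let ?I = "I \<times> (UNIV :: 'm set)"
  show "der ?I ((\<lambda>p. snd p \<^bold>\<in> s (fst p)) # map (\<lambda>H p. H (fst p)) G)
     (\<lambda>p. snd p \<^bold>= a (fst p) \<^bold>\<or> snd p \<^bold>= b (fst p))"
    by (rule der_upairE[where s = "\<lambda>p. s (fst p)" and a = "\<lambda>p. a (fst p)" and b = "\<lambda>p. b (fst p)",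
          OF der_hyp1], use assms in force)
      ((rule der_orI1, rule der_eqI, simp; fail), rule der_orI2, rule der_eqI, simp)
  show "der ?I ((\<lambda>p. snd p \<^bold>= a (fst p) \<^bold>\<or> snd p \<^bold>= b (fst p)) # map (\<lambda>H p. H (fst p)) G)
     (\<lambda>p. snd p \<^bold>\<in> s (fst p))"
  proof (rule der_orE[OF der_hyp1])
    note up = der_upairI[where s = "\<lambda>p. s (fst p)" and a = "\<lambda>p. a (fst p)" and b = "\<lambda>p. b (fst p)"]
    show "der ?I ((\<lambda>p. snd p \<^bold>= a (fst p)) # G') (\<lambda>p. snd p \<^bold>\<in> s (fst p))"
       "der ?I ((\<lambda>p. snd p \<^bold>= b (fst p)) # G') (\<lambda>p. snd p \<^bold>\<in> s (fst p))" for G'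
      by (rule der_eqE[OF der_hyp1], rule der_mono[OF up(1)] der_mono[OF up(2)]; use assms in force)+
  qed
qed

lemma der_Is_upairD:
  assumes "der I G (\<lambda>i. Is_upair (s i) (x i) (y i))"
  shows "der I G (\<lambda>i. x i \<^bold>\<in> s i)" "der I G (\<lambda>i. y i \<^bold>\<in> s i)"
  by (rule der_iffD2[OF der_allE[OF assms[unfolded Is_upair_def]]], rule der_orI1 der_orI2, rule der_eqI, rule refl)+

lemma der_Is_upairE:
  assumes "der I G (\<lambda>i. Is_upair (s i) (x i) (y i))" "der I G (\<lambda>i. u i \<^bold>\<in> s i)"
    and "\<And>J. J \<subseteq> I \<Longrightarrow> (\<And>i. i \<in> J \<Longrightarrow> u i = x i) \<Longrightarrow> der J G F"
    and "\<And>J. J \<subseteq> I \<Longrightarrow> (\<And>i. i \<in> J \<Longrightarrow> u i = y i) \<Longrightarrow> der J G F"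
  shows "der I G F"
proof (rule der_orE[OF der_iffD1[OF der_allE[OF assms(1)[unfolded Is_upair_def]] assms(2)]])
  show "der I ((\<lambda>i. u i \<^bold>= x i) # G) F"
    by (rule der_eqE[OF der_hyp1], rule der_weaken1, rule assms(3))
  show "der I ((\<lambda>i. u i \<^bold>= y i) # G) F"
    by (rule der_eqE[OF der_hyp1], rule der_weaken1, rule assms(4))
qed

text \<open>Kuratowski's pair as seen in the realizability model, in contrast to
  \<open>opair\<close>, which in the ground model attaches stacks to elements.\<close>

definition kpair :: "'m \<Rightarrow> 'm \<Rightarrow> 'm" where
  "kpair x y = upair (upair x x) (upair x y)"

lemma der_Is_opairI:
  assumes "\<And>i. i \<in> I \<Longrightarrow> q i = kpair (x i) (y i)"
  shows "der I G (\<lambda>i. Is_opair (q i) (x i) (y i))"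
  unfolding Is_opair_def
  by (rule der_exI[where a = "\<lambda>i. upair (x i) (x i)"], rule der_exI[where a = "\<lambda>i. upair (x i) (y i)"])
    (intro der_andI der_Is_upairI; simp add: assms kpair_def)

text \<open>Injectivity of Kuratowski pairs, with every equality used by shrinking the index set.
  The result is stated as a formula because \<open>s\<close> and \<open>t\<close> come from
  existential quantifiers: a restriction of the enlarged index set could not be carried back to the
  original one, but a formula not mentioning \<open>s\<close> and \<open>t\<close> can.\<close>

lemma der_Is_opair_crisp:
  assumes q: "\<And>i. i \<in> I \<Longrightarrow> q i = kpair (x0 i) (y0 i)"
    and qu: "der I G (\<lambda>i. Is_upair (q i) (s i) (t i))"
    and su: "der I G (\<lambda>i. Is_upair (s i) (x i) (x i))"
    and tu: "der I G (\<lambda>i. Is_upair (t i) (x i) (y i))"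
  shows "der I G (\<lambda>i. (if x i = x0 i \<and> y i = y0 i then Bot else Top) \<^bold>\<rightarrow> Bot)" (is "der I G ?F")
proof -
  note up = q[unfolded kpair_def]
  \<comment> \<open>Whichever of the two members of \<open>q\<close> equals \<open>s\<close>, it
    contains \<open>x0\<close>, while \<open>x\<close> is the only member of
    \<open>s\<close>.\<close>
  have x: "der I G ?F" if *: "\<And>J. J \<subseteq> I \<Longrightarrow> (\<And>i. i \<in> J \<Longrightarrow> x0 i = x i) \<Longrightarrow> der J G ?F"
  proof -
    have x: "der J G ?F" if J: "J \<subseteq> I" and "der J G (\<lambda>i. x0 i \<^bold>\<in> s i)" for J
      by (rule der_Is_upairE[OF der_subset[OF su J] that(2)]) (rule *, use J in auto)+
    show ?thesis
    proof (rule der_upairE[OF der_Is_upairD(1)[OF qu] up])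
      fix J assume J: "J \<subseteq> I"
      show "der J G ?F" if "\<And>i. i \<in> J \<Longrightarrow> s i = upair (x0 i) (x0 i)"
        by (rule x[OF J der_upairI(1)]) (rule that)
      show "der J G ?F" if "\<And>i. i \<in> J \<Longrightarrow> s i = upair (x0 i) (y0 i)"
        by (rule x[OF J der_upairI(1)]) (rule that)
    qed
  qed
  show ?thesis
  proof (rule x)
    fix J assume J: "J \<subseteq> I" and x: "\<And>i. i \<in> J \<Longrightarrow> x0 i = x i"
    note tu' = der_subset[OF tu] and qu' = der_subset[OF qu] and su' = der_subset[OF su]
    have up': "\<And>i. i \<in> J \<Longrightarrow> q i = upair (upair (x0 i) (x0 i)) (upair (x0 i) (y0 i))" using up J by blast
    show "der J G ?F"
    proof (rule der_upairE[OF der_Is_upairD(2)[OF qu'[OF J]] up'])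
      fix J' assume J': "J' \<subseteq> J" and t: "\<And>i. i \<in> J' \<Longrightarrow> t i = upair (x0 i) (y0 i)"
      have I: "J' \<subseteq> I" using J J' by blast
      show "der J' G ?F"
      proof (rule der_Is_upairE[OF tu'[OF I] der_upairI(2)[OF t]])
        fix K assume K: "K \<subseteq> J'" and y0: "\<And>i. i \<in> K \<Longrightarrow> y0 i = x i"
        have t': "t i = upair (x0 i) (y0 i)" if "i \<in> K" for i using t K that by blast
        have KI: "K \<subseteq> I" using K I by blast
        show "der K G ?F"
          by (rule der_upairE[OF der_Is_upairD(2)[OF tu'[OF KI]] t'], assumption)
            (rule der_crispI, use x y0 K J' in \<open>metis subsetD\<close>)+
      next
        fix K assume "K \<subseteq> J'" and "\<And>i. i \<in> K \<Longrightarrow> y0 i = y i"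
        then show "der K G ?F" by (intro der_crispI) (use x J' in \<open>metis subsetD\<close>)
      qed
    next
      fix J' assume J': "J' \<subseteq> J" and t: "\<And>i. i \<in> J' \<Longrightarrow> t i = upair (x0 i) (x0 i)"
      have I: "J' \<subseteq> I" using J J' by blast
      have y: "der J' G ?F" if *: "\<And>K. K \<subseteq> J' \<Longrightarrow> (\<And>i. i \<in> K \<Longrightarrow> y i = x0 i) \<Longrightarrow> der K G ?F"
        by (rule der_upairE[OF der_Is_upairD(2)[OF tu'[OF I]] t], assumption) (rule *; assumption)+
      show "der J' G ?F"
      proof (rule y)
        fix K assume K: "K \<subseteq> J'" and y: "\<And>i. i \<in> K \<Longrightarrow> y i = x0 i"
        have I: "K \<subseteq> I" using I K by blast
        have up'': "\<And>i. i \<in> K \<Longrightarrow> q i = upair (upair (x0 i) (x0 i)) (upair (x0 i) (y0 i))" using up I by blast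
        show "der K G ?F"
        \<comment> \<open>Now x = y = x0, and \<open>y0\<close> remains to be identified. The second
          member of \<open>q\<close> must be \<open>s\<close> or \<open>t\<close>, and both have no
          members but \<open>x\<close> and \<open>y\<close>.\<close>
        proof (rule der_Is_upairE[OF qu'[OF I] der_upairI(2)[OF up'']])
          fix L assume L: "L \<subseteq> K" and s: "\<And>i. i \<in> L \<Longrightarrow> upair (x0 i) (y0 i) = s i"
          have LI: "L \<subseteq> I" using I L by blast
          show "der L G ?F"
            by (rule der_Is_upairE[OF su'[OF LI] der_upairI(2)[OF s[symmetric]]], assumption)
              (rule der_crispI, use x y L K J' in \<open>metis subsetD\<close>)+
        next
          fix L assume L: "L \<subseteq> K" and t: "\<And>i. i \<in> L \<Longrightarrow> upair (x0 i) (y0 i) = t i"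
          have LI: "L \<subseteq> I" using I L by blast
          show "der L G ?F"
            by (rule der_Is_upairE[OF tu'[OF LI] der_upairI(2)[OF t[symmetric]]], assumption)
              (rule der_crispI, use x y L K J' in \<open>metis subsetD\<close>)+
        qed
      qed
    qed
  qed
qed

lemma der_Is_opairE:
  assumes op: "der I G (\<lambda>i. Is_opair (q i) (x i) (y i))"
    and q: "\<And>i. i \<in> I \<Longrightarrow> q i = kpair (a i) (b i)"
    and C: "\<And>J. J \<subseteq> I \<Longrightarrow> (\<And>i. i \<in> J \<Longrightarrow> x i = a i \<and> y i = b i) \<Longrightarrow> der J G C"
  shows "der I G C"
proof (rule der_crispE[OF _ C])
  show "der I G (\<lambda>i. (if x i = a i \<and> y i = b i then Bot else Top) \<^bold>\<rightarrow> Bot)"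
  proof (rule der_exE[OF op[unfolded Is_opair_def]], rule der_exE[OF der_hyp1],
      rule der_Is_opair_crisp[where q = "\<lambda>p. q (fst (fst p))" and s = "\<lambda>p. snd (fst p)" and t = snd])
    fix p assume "p \<in> (I \<times> (UNIV :: 'm set)) \<times> (UNIV :: 'm set)"
    then show "q (fst (fst p)) = kpair (a (fst (fst p))) (b (fst (fst p)))" using q by auto
  qed (rule der_andE1[OF der_hyp1] der_andE1[OF der_andE2[OF der_hyp1]] der_andE2[OF der_andE2[OF der_hyp1]])+
qed

end

section \<open>The surjection\<close>

context zf_model
begin

lemma emb_if_bij:
  assumes "is_bij E f a b"
  shows "emb a b"
proof (rule embI_rel[of "\<lambda>x y. opair E x y \<in>\<^sub>M f"], intro dfb)
  have f: "\<exists>!y. opair E x y \<in>\<^sub>M f" if "x \<in>\<^sub>M a" for x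
    using assms that unfolding is_bij_def is_map_def is_fun_def by simp
  then have ap: "opair E x (ap E f x) \<in>\<^sub>M f" if "x \<in>\<^sub>M a" for x
    unfolding ap_def using that by (metis theI')
  have apb: "ap E f x \<in>\<^sub>M b" if "x \<in>\<^sub>M a" for x
    using assms that unfolding is_bij_def is_map_def by simp
  show "\<exists>y. y \<in>\<^sub>M b \<and> opair E x y \<in>\<^sub>M f" if "x \<in>\<^sub>M a" for x
    using ap apb that by blast
  show un: "y = y'" if "x \<in>\<^sub>M a" "opair E x y \<in>\<^sub>M f" "opair E x y' \<in>\<^sub>M f" for x y y'
    using f[OF that(1)] that by blast
  show "x = x'" if "x \<in>\<^sub>M a" "x' \<in>\<^sub>M a" "opair E x y \<in>\<^sub>M f" "opair E x' y \<in>\<^sub>M f" for x x' y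
  proof -
    have "ap E f x = y" "ap E f x' = y" using un ap that by blast+
    moreover have "\<exists>!x. x \<in>\<^sub>M a \<and> ap E f x = y"
      using assms apb[OF that(1)] \<open>ap E f x = y\<close> unfolding is_bij_def by simp
    ultimately show ?thesis using that by blast
  qed
qed

lemma definable_surjection_if_emb:
  assumes "emb b a"
  obtains h where "dtm (\<lambda>v. h (v 0))" "\<And>x z. z \<in>\<^sub>M h x \<Longrightarrow> z \<in>\<^sub>M b"
    "\<And>y. y \<in>\<^sub>M pow E b \<Longrightarrow> \<exists>x. x \<in>\<^sub>M pow E a \<and> h x = y"
proof -
  obtain J where J: "dtm (\<lambda>v. J (v 0))" "\<And>x. x \<in>\<^sub>M b \<Longrightarrow> J x \<in>\<^sub>M a"
    "\<And>x y. x \<in>\<^sub>M b \<Longrightarrow> y \<in>\<^sub>M b \<Longrightarrow> J x = J y \<Longrightarrow> x = y" using assms by (rule embE) blast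
  define h where "h x = coll E {c. c \<in>\<^sub>M b \<and> J c \<in>\<^sub>M x}" for x
  have mem: "c \<in>\<^sub>M h x \<longleftrightarrow> c \<in>\<^sub>M b \<and> J c \<in>\<^sub>M x" for c x
  proof -
    have "is_set E {c. c \<in>\<^sub>M b \<and> J c \<in>\<^sub>M x}"
      by (rule dfbl_separation) (intro dfb dtm_app[OF J(1)])
    then show ?thesis by (simp add: h_def mem_coll)
  qed
  show ?thesis
  proof (rule that)
    show "dtm (\<lambda>v. h (v 0))" unfolding h_def by (intro dfb dtm_app[OF J(1)])
    show "z \<in>\<^sub>M b" if "z \<in>\<^sub>M h x" for z x using that mem by blast
    fix y assume y: "y \<in>\<^sub>M pow E b"
    let ?x = "coll E {u. \<exists>c. c \<in>\<^sub>M y \<and> u = J c}"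
    have x: "u \<in>\<^sub>M ?x \<longleftrightarrow> (\<exists>c. c \<in>\<^sub>M y \<and> u = J c)" for u
      using is_set_image[OF J(1)] by (simp add: mem_coll)
    have "h ?x = y"
      by (rule extensionality) (use y J(3) in \<open>auto simp: mem x\<close>)
    moreover have "?x \<in>\<^sub>M pow E a" using x y J(2) by auto
    ultimately show "\<exists>x. x \<in>\<^sub>M pow E a \<and> h x = y" by blast
  qed
qed

end

context realizability_model
begin

lemma dtm_kpair [dfb]: "dtm t \<Longrightarrow> dtm s \<Longrightarrow> dtm (\<lambda>v. kpair (t v) (s v))"
  unfolding kpair_def by (intro dfb)

lemma emb_cprod_Stk:
  assumes "is_card_of E \<kappa> (cup E (cup E (Tm A) (Stk A)) (omega E))"
  shows "emb (cprod E \<kappa> (Stk A)) \<kappa>"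
proof -
  have ord: "ordinal E \<kappa>" and "emb (cup E (cup E (Tm A) (Stk A)) (omega E)) \<kappa>"
    using assms emb_if_bij unfolding is_card_of_def by blast+
  then have sub: "emb a \<kappa>" if "\<And>x. x \<in>\<^sub>M a \<Longrightarrow> x \<in>\<^sub>M cup E (cup E (Tm A) (Stk A)) (omega E)" for a
    using that emb_subset emb_trans by blast
  have omega: "emb (omega E) \<kappa>" and stk: "emb (Stk A) \<kappa>" by (rule sub, simp)+
  have "\<not> \<kappa> \<in>\<^sub>M omega E" using omega emb_omega_nat by blast
  then have "emb (cprod E \<kappa> \<kappa>) \<kappa>"
    using ordinal_finite_or_infinite[OF ord] emb_ordinal_square[OF ord] by blast
  moreover have "emb (cprod E \<kappa> (Stk A)) (cprod E \<kappa> \<kappa>)"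
    by (rule emb_cprod[OF _ stk]) (rule emb_subset)
  ultimately show ?thesis using emb_trans by blast
qed

lemma fv_Eps_mono: "fv (NotEps z x) \<subseteq> fv (NotEps z y) \<Longrightarrow> fv (z \<^bold>\<in> y) \<subseteq> fv (z \<^bold>\<in> x)"
  unfolding Eps_def Negation_def by (rule fv_imp_mono) (assumption, simp)

text \<open>An individual included in X \<times> \<Pi> has its falsity values for non-membership
  included in those of \<open>gimel E A X\<close>, so the identity realizes the inclusion.
  Conversely a subset \<open>x\<close> is represented by its trace on X \<times> \<Pi>: at elements
  of \<open>X\<close> both give the same falsity value, and the inclusion hypothesis restricts the
  indices to these.\<close>

lemma der_Is_pow_gimel: "der (UNIV :: unit set) []
    (\<lambda>_. Is_pow (gimel E A (pow E (cprod E X (Stk A)))) (gimel E A X))"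
proof -
  let ?P = "gimel E A (pow E (cprod E X (Stk A)))" and ?X = "gimel E A X"
  let ?I = "(UNIV :: unit set) \<times> (UNIV :: 'm set)"
  show ?thesis
    unfolding Is_pow_def
  proof (rule der_andI; rule der_allI; rule der_impI; unfold list.map)
    show "der ?I [\<lambda>p. snd p \<^bold>\<in> ?P] (\<lambda>p. Subset (snd p) ?X)"
    proof (rule der_gimelE[OF der_hyp1])
      fix J :: "(unit \<times> 'm) set" assume J: "\<And>i. i \<in> J \<Longrightarrow> snd i \<in>\<^sub>M pow E (cprod E X (Stk A))"
      show "der J [\<lambda>p. snd p \<^bold>\<in> ?P] (\<lambda>p. Subset (snd p) ?X)"
        unfolding Subset_def
      proof (rule der_allI, rule der_impI, rule der_mono[OF der_hyp1], rule fv_Eps_mono)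
        fix i assume "i \<in> J \<times> (UNIV :: 'm set)"
        then have "snd (fst i) \<in>\<^sub>M pow E (cprod E X (Stk A))" using J by auto
        then show "fv (NotEps (snd i) (snd (fst i))) \<subseteq> fv (NotEps (snd i) ?X)"
          by (auto simp: mem_gimel)
      qed
    qed
  next
    have cap: "c \<in>\<^sub>M cap E x y \<longleftrightarrow> c \<in>\<^sub>M x \<and> c \<in>\<^sub>M y" for c x y
    proof -
      have "is_set E {c. c \<in>\<^sub>M x \<and> c \<in>\<^sub>M y}" by (rule dfbl_separation) (intro dfb)
      then show ?thesis by (simp add: cap_def mem_coll ext_def Int_def)
    qed
    let ?y = "\<lambda>x. cap E x (cprod E X (Stk A))"
    have fv: "fv (NotEps z (?y x)) = (if z \<in>\<^sub>M X then fv (NotEps z x) else {})" for z x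
      by (auto simp: cap)
    show "der ?I [\<lambda>p. Subset (snd p) ?X]
       (\<lambda>p. \<^bold>\<exists>y. y \<^bold>\<in> ?P \<^bold>\<and> (\<^bold>\<forall>z. z \<^bold>\<in> y \<^bold>\<leftrightarrow> z \<^bold>\<in> snd p))"
    proof (rule der_exI[where a = "\<lambda>p. ?y (snd p)"], rule der_andI)
      show "der ?I [\<lambda>p. Subset (snd p) ?X] (\<lambda>p. ?y (snd p) \<^bold>\<in> ?P)"
        by (rule der_gimelI) (simp add: cap)
      show "der ?I [\<lambda>p. Subset (snd p) ?X] (\<lambda>p. \<^bold>\<forall>z. z \<^bold>\<in> ?y (snd p) \<^bold>\<leftrightarrow> z \<^bold>\<in> snd p)"
      proof (rule der_allI, rule der_iffI; unfold list.map)
        let ?S = "\<lambda>p :: (unit \<times> 'm) \<times> 'm. Subset (snd (fst p)) ?X"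
        show "der (?I \<times> UNIV) [\<lambda>p. snd p \<^bold>\<in> ?y (snd (fst p)), ?S] (\<lambda>p. snd p \<^bold>\<in> snd (fst p))"
          by (rule der_mono[OF der_hyp1], rule fv_Eps_mono) (simp only: fv, simp)
        show "der (?I \<times> UNIV) [\<lambda>p. snd p \<^bold>\<in> snd (fst p), ?S] (\<lambda>p. snd p \<^bold>\<in> ?y (snd (fst p)))"
        proof (rule der_gimelE)
          show "der (?I \<times> UNIV) [\<lambda>p. snd p \<^bold>\<in> snd (fst p), ?S] (\<lambda>p. snd p \<^bold>\<in> ?X)"
            by (rule der_mp[OF der_allE[where a = snd] der_hyp1])
              (rule der_hyp, simp add: Subset_def)
          fix J :: "((unit \<times> 'm) \<times> 'm) set" assume "\<And>i. i \<in> J \<Longrightarrow> snd i \<in>\<^sub>M X"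
          then show "der J [\<lambda>p. snd p \<^bold>\<in> snd (fst p), ?S] (\<lambda>p. snd p \<^bold>\<in> ?y (snd (fst p)))"
            by (intro der_mono[OF der_hyp1] fv_Eps_mono) (simp only: fv, simp)
        qed
      qed
    qed
  qed
qed

lemma der_Is_surj_gimel:
  assumes h: "dtm (\<lambda>v. h (v 0))" "\<And>x. x \<in>\<^sub>M X \<Longrightarrow> h x \<in>\<^sub>M Y"
    "\<And>y. y \<in>\<^sub>M Y \<Longrightarrow> \<exists>x. x \<in>\<^sub>M X \<and> h x = y"
  shows "der (UNIV :: unit set) [] (\<lambda>_. Is_surj (gimel E A (coll E {q. \<exists>x. x \<in>\<^sub>M X \<and> q = kpair x (h x)}))
     (gimel E A X) (gimel E A Y))"
proof -
  let ?g = "coll E {q. \<exists>x. x \<in>\<^sub>M X \<and> q = kpair x (h x)}"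
  let ?f = "gimel E A ?g" and ?X = "gimel E A X" and ?Y = "gimel E A Y"
  have "dtm (\<lambda>v. kpair (v 0) (h (v 0)))" by (intro dfb h(1))
  then have g: "q \<in>\<^sub>M ?g \<longleftrightarrow> (\<exists>x. x \<in>\<^sub>M X \<and> q = kpair x (h x))" for q
    using is_set_image[of "\<lambda>x. kpair x (h x)"] by (simp add: mem_coll)
  \<comment> \<open>HOL choice is sufficient, since \<open>arg\<close> only supplies witnesses and
    is never asked to be definable.\<close>
  define arg where "arg q = (SOME x. x \<in>\<^sub>M X \<and> q = kpair x (h x))" for q
  have arg: "arg q \<in>\<^sub>M X \<and> q = kpair (arg q) (h (arg q))" if "q \<in>\<^sub>M ?g" for q
    using someI_ex[OF that[unfolded g]] unfolding arg_def .
  show ?thesis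
    unfolding Is_surj_def Is_map_def
  proof (intro der_andI)
    show "der (UNIV :: unit set) [] (\<lambda>_. \<^bold>\<forall>q. q \<^bold>\<in> ?f \<^bold>\<rightarrow> (\<^bold>\<exists>x. \<^bold>\<exists>y. x \<^bold>\<in> ?X \<^bold>\<and> y \<^bold>\<in> ?Y \<^bold>\<and> Is_opair q x y))"
    proof (rule der_allI, rule der_impI, rule der_gimelE[OF der_hyp1], unfold list.map)
      fix J :: "(unit \<times> 'm) set" assume J: "\<And>i. i \<in> J \<Longrightarrow> snd i \<in>\<^sub>M ?g"
      show "der J [\<lambda>p. snd p \<^bold>\<in> ?f] (\<lambda>p. \<^bold>\<exists>x. \<^bold>\<exists>y. x \<^bold>\<in> ?X \<^bold>\<and> y \<^bold>\<in> ?Y \<^bold>\<and> Is_opair (snd p) x y)"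
        by (rule der_exI[where a = "\<lambda>p. arg (snd p)"], rule der_exI[where a = "\<lambda>p. h (arg (snd p))"],
            intro der_andI der_gimelI der_Is_opairI) (use J arg h(2) in blast)+
    qed
    show "der (UNIV :: unit set) [] (\<lambda>_. \<^bold>\<forall>x. x \<^bold>\<in> ?X \<^bold>\<rightarrow> (\<^bold>\<exists>y. \<^bold>\<exists>q. q \<^bold>\<in> ?f \<^bold>\<and> Is_opair q x y))"
    proof (rule der_allI, rule der_impI, rule der_gimelE[OF der_hyp1], unfold list.map)
      fix J :: "(unit \<times> 'm) set" assume J: "\<And>i. i \<in> J \<Longrightarrow> snd i \<in>\<^sub>M X"
      show "der J [\<lambda>p. snd p \<^bold>\<in> ?X] (\<lambda>p. \<^bold>\<exists>y. \<^bold>\<exists>q. q \<^bold>\<in> ?f \<^bold>\<and> Is_opair q (snd p) y)"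
        by (rule der_exI[where a = "\<lambda>p. h (snd p)"], rule der_exI[where a = "\<lambda>p. kpair (snd p) (h (snd p))"],
            intro der_andI der_gimelI der_Is_opairI) (use J g in blast)+
    qed
    show "der (UNIV :: unit set) [] (\<lambda>_. \<^bold>\<forall>x. \<^bold>\<forall>y. \<^bold>\<forall>y'. \<^bold>\<forall>q. \<^bold>\<forall>q'. q \<^bold>\<in> ?f \<^bold>\<rightarrow> q' \<^bold>\<in> ?f \<^bold>\<rightarrow>
         Is_opair q x y \<^bold>\<rightarrow> Is_opair q' x y' \<^bold>\<rightarrow> y \<^bold>= y')"
    proof (intro der_allI der_impI, unfold list.map)
      \<comment> \<open>An index now lists the instances of the five bound variables x, y, y', q,
        q', the last one outermost. Reading both pairs through \<open>arg\<close> gives x = arg q =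
        arg q', hence y = h x = y'.\<close>
      let ?K = "((((UNIV :: unit set) \<times> (UNIV :: 'm set)) \<times> (UNIV :: 'm set)) \<times> (UNIV :: 'm set)) \<times> (UNIV :: 'm set)"
      let ?q' = "\<lambda>p :: ((((unit \<times> 'm) \<times> 'm) \<times> 'm) \<times> 'm) \<times> 'm. snd p"
      let ?q = "\<lambda>p :: ((((unit \<times> 'm) \<times> 'm) \<times> 'm) \<times> 'm) \<times> 'm. snd (fst p)"
      let ?y' = "\<lambda>p :: ((((unit \<times> 'm) \<times> 'm) \<times> 'm) \<times> 'm) \<times> 'm. snd (fst (fst p))"
      let ?y = "\<lambda>p :: ((((unit \<times> 'm) \<times> 'm) \<times> 'm) \<times> 'm) \<times> 'm. snd (fst (fst (fst p)))"
      let ?x = "\<lambda>p :: ((((unit \<times> 'm) \<times> 'm) \<times> 'm) \<times> 'm) \<times> 'm. snd (fst (fst (fst (fst p))))"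
      let ?G = "[\<lambda>p. Is_opair (?q' p) (?x p) (?y' p), \<lambda>p. Is_opair (?q p) (?x p) (?y p),
        \<lambda>p. ?q' p \<^bold>\<in> ?f, \<lambda>p. ?q p \<^bold>\<in> ?f]"
      show "der (?K \<times> UNIV) ?G (\<lambda>p. ?y p \<^bold>= ?y' p)"
      proof (rule der_gimelE[where z = ?q'])
        show "der (?K \<times> UNIV) ?G (\<lambda>p. ?q' p \<^bold>\<in> ?f)" by (rule der_hyp) simp
        fix J :: "(((((unit \<times> 'm) \<times> 'm) \<times> 'm) \<times> 'm) \<times> 'm) set" assume q': "\<And>i. i \<in> J \<Longrightarrow> ?q' i \<in>\<^sub>M ?g"
        show "der J ?G (\<lambda>p. ?y p \<^bold>= ?y' p)"
        proof (rule der_gimelE[where z = ?q])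
          show "der J ?G (\<lambda>p. ?q p \<^bold>\<in> ?f)" by (rule der_hyp) simp
          fix J' :: "(((((unit \<times> 'm) \<times> 'm) \<times> 'm) \<times> 'm) \<times> 'm) set" assume J': "J' \<subseteq> J" and q: "\<And>i. i \<in> J' \<Longrightarrow> ?q i \<in>\<^sub>M ?g"
          show "der J' ?G (\<lambda>p. ?y p \<^bold>= ?y' p)"
          proof (rule der_Is_opairE[where q = ?q and x = ?x and y = ?y and
                a = "\<lambda>p. arg (?q p)" and b = "\<lambda>p. h (arg (?q p))"])
            show "der J' ?G (\<lambda>p. Is_opair (?q p) (?x p) (?y p))" by (rule der_hyp) simp
            show "?q i = kpair (arg (?q i)) (h (arg (?q i)))" if "i \<in> J'" for i using arg q that by blast
            fix L :: "(((((unit \<times> 'm) \<times> 'm) \<times> 'm) \<times> 'm) \<times> 'm) set" assume L: "L \<subseteq> J'" and 1: "\<And>i. i \<in> L \<Longrightarrow> ?x i = arg (?q i) \<and> ?y i = h (arg (?q i))"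
            show "der L ?G (\<lambda>p. ?y p \<^bold>= ?y' p)"
            proof (rule der_Is_opairE[where q = ?q' and x = ?x and y = ?y' and
                  a = "\<lambda>p. arg (?q' p)" and b = "\<lambda>p. h (arg (?q' p))"])
              show "der L ?G (\<lambda>p. Is_opair (?q' p) (?x p) (?y' p))" by (rule der_hyp) simp
              show "?q' i = kpair (arg (?q' i)) (h (arg (?q' i)))" if "i \<in> L" for i
                using arg q' that L J' by blast
              fix L' :: "(((((unit \<times> 'm) \<times> 'm) \<times> 'm) \<times> 'm) \<times> 'm) set" assume "L' \<subseteq> L" "\<And>i. i \<in> L' \<Longrightarrow> ?x i = arg (?q' i) \<and> ?y' i = h (arg (?q' i))"
              then show "der L' ?G (\<lambda>p. ?y p \<^bold>= ?y' p)"
                by (intro der_eqI) (use 1 in \<open>metis subsetD\<close>)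
            qed
          qed
        qed
      qed
    qed
    show "der (UNIV :: unit set) [] (\<lambda>_. \<^bold>\<forall>y. y \<^bold>\<in> ?Y \<^bold>\<rightarrow> (\<^bold>\<exists>x. \<^bold>\<exists>q. x \<^bold>\<in> ?X \<^bold>\<and> q \<^bold>\<in> ?f \<^bold>\<and> Is_opair q x y))"
    proof (rule der_allI, rule der_impI, rule der_gimelE[OF der_hyp1], unfold list.map)
      fix J :: "(unit \<times> 'm) set" assume J: "\<And>i. i \<in> J \<Longrightarrow> snd i \<in>\<^sub>M Y"
      \<comment> \<open>Preimages are again chosen outside the structure, as witnesses only.\<close>
      define pre where "pre y = (SOME x. x \<in>\<^sub>M X \<and> h x = y)" for y
      have pre: "pre (snd i) \<in>\<^sub>M X \<and> h (pre (snd i)) = snd i" if "i \<in> J" for i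
        unfolding pre_def by (rule someI_ex[OF h(3)[OF J[OF that]]])
      have mem: "kpair (pre (snd i)) (snd i) \<in>\<^sub>M ?g" if "i \<in> J" for i
        unfolding g using pre[OF that] by (intro exI[of _ "pre (snd i)"]) simp
      show "der J [\<lambda>p. snd p \<^bold>\<in> ?Y] (\<lambda>p. \<^bold>\<exists>x. \<^bold>\<exists>q. x \<^bold>\<in> ?X \<^bold>\<and> q \<^bold>\<in> ?f \<^bold>\<and> Is_opair q x (snd p))"
        by (rule der_exI[where a = "\<lambda>p. pre (snd p)"],
            rule der_exI[where a = "\<lambda>p. kpair (pre (snd p)) (snd p)"],
            intro der_andI der_gimelI der_Is_opairI) (simp_all only: pre mem)
    qed
  qed
qed

end

theorem theorem24:
  fixes E :: "'m \<Rightarrow> 'm \<Rightarrow> bool"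
    and A :: "'m ralg"
    and \<kappa> \<kappa>' :: 'm
  assumes "ZF E"
    and "V_eq_L E"
    and "realizability_algebra E A"
    and "coherent E A"
    and "is_card_of E \<kappa> (cup E (cup E (Tm A) (Stk A)) (omega E))"
    and "\<kappa>' = pow E \<kappa>"
  shows "realized E A (Exists_surj_onto_pow (gimel E A \<kappa>') (gimel E A \<kappa>))"
proof -
  interpret realizability_model E A by unfold_locales (fact assms(1), fact assms(3))
  obtain h where h: "dtm (\<lambda>v. h (v 0))" "\<And>x z. E z (h x) \<Longrightarrow> E z (cprod E \<kappa> (Stk A))"
    "\<And>y. E y (pow E (cprod E \<kappa> (Stk A))) \<Longrightarrow> \<exists>x. E x (pow E \<kappa>) \<and> h x = y"
    using definable_surjection_if_emb[OF emb_cprod_Stk[OF assms(5)]] by blast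
  have "der (UNIV :: unit set) [] (\<lambda>_. Exists_surj_onto_pow (gimel E A \<kappa>') (gimel E A \<kappa>))"
    unfolding Exists_surj_onto_pow_def assms(6)
    by (rule der_exI, rule der_andI, rule der_Is_pow_gimel, rule der_exI, rule der_Is_surj_gimel[of h])
      (use h in simp_all)
  then show ?thesis by (rule realized_if_der) simp
qed

end
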